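(* Let $d\ge2$ be an integer, $\eta>0$, $1\le p\le2$, and let $f\in L^p(\mathbb{T}^d)$. Assume that there is a constant $A(f)$ (depending on $f$ but not on $\delta$) such that $$\omega(\delta,f)_p\le \frac{A(f)}{(\log(1/\delta))^{d/p}\,\log\log(e^e/\delta)\,\bigl(\log\log\log(e^{e^e}/\delta)\bigr)^{1+\eta}},\qquad 0<\delta\le\tfrac12 .$$ Then the $d$-dimensional rectangular Fourier series of $f$ converges almost everywhere in the sense of Pringsheim; that is, for almost every $x\in\mathbb{T}^d$, $S_{\mathbf{n}}f(x)\to f(x)$ as $\min_{1\le j\le d}n_j\to\infty$.
   Context: $\mathbb{T}=\mathbb{R}/(2\pi\mathbb{Z})$, and $\mathbb{T}^d$ carries the normalized Haar measure $dm_d(x)=(2\pi)^{-d}dx$; $\|\cdot\|_p$ is the norm of $L^p(\mathbb{T}^d)$ with respect to $m_d$. For $t\in\mathbb{T}$, $|t|_{\mathbb{T}}=\operatorname{dist}(t,2\pi\mathbb{Z})\in[0,\pi]$, and for $h=(h_1,\dots,h_d)\in\mathbb{T}^d$, $\|h\|_{\mathbb{T}^d}=\max_{1\le j\le d}|h_j|_{\mathbb{T}}$. The $L^p$ modulus of continuity is $\omega(\delta,f)_p=\sup_{\|h\|_{\mathbb{T}^d}\le\delta}\|f(\cdot+h)-f(\cdot)\|_p$ for $\delta>0$. Fourier coefficients: $\widehat f(\mathbf{k})=\int_{\mathbb{T}^d}f(x)e^{-i\mathbf{k}\cdot x}\,dm_d(x)$, $\mathbf{k}\in\mathbb{Z}^d$.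 For $\mathbf{n}=(n_1,\dots,n_d)\in\mathbb{N}_0^d$ the symmetric rectangular partial sum is $$S_{\mathbf{n}}f(x)=\sum_{|k_1|\le n_1}\cdots\sum_{|k_d|\le n_d}\widehat f(\mathbf{k})e^{i\mathbf{k}\cdot x}.$$ Convergence of the rectangular Fourier series in the sense of Pringsheim at $x$ means $S_{\mathbf{n}}f(x)\to f(x)$ as $\min_{1\le j\le d} n_j\to\infty$. All logarithms are natural. *)

theory Defs
  imports "HOL-Analysis.Analysis"
begin

text \<open>
  Functions on the torus $(\mathbf{R}/2\pi\mathbf{Z})^d$ are represented by functions on
  \<open>real ^ 'd\<close> that are \<open>2 * pi\<close>-periodic in every coordinate, with \<open>d = CARD('d)\<close>.
\<close>

definition torus_periodic :: "(real ^ 'd \<Rightarrow> 'a) \<Rightarrow> bool" where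
  "torus_periodic f \<longleftrightarrow> (\<forall>x j. f (x + axis j (2 * pi)) = f x)"

text \<open>
  Normalized Haar measure, carried by the fundamental domain $[0,2\pi)^d$; it vanishes
  outside that domain, although its underlying space is all of \<open>real ^ 'd\<close>.
\<close>

definition torus_measure :: "(real ^ 'd) measure" where
  "torus_measure =
     density lebesgue
       (\<lambda>x. ennreal (indicator {x. \<forall>j. 0 \<le> x $ j \<and> x $ j < 2 * pi} x / (2 * pi) ^ CARD('d)))"

definition torus_Lp :: "real \<Rightarrow> (real ^ 'd \<Rightarrow> complex) set" where
  "torus_Lp p =
     {f. torus_periodic f \<and> f \<in> borel_measurable lebesgue \<and>
         integrable torus_measure (\<lambda>x. norm (f x) powr p)}"

definition torus_Lp_norm :: "real \<Rightarrow> (real ^ 'd \<Rightarrow> complex) \<Rightarrow> real" where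
  "torus_Lp_norm p f = (LINT x|torus_measure. norm (f x) powr p) powr (1 / p)"

definition circle_abs :: "real \<Rightarrow> real" where
  "circle_abs t = infdist t (range (\<lambda>k::int. 2 * pi * of_int k))"

definition torus_abs :: "real ^ 'd \<Rightarrow> real" where
  "torus_abs h = (MAX j. circle_abs (h $ j))"

text \<open>The supremum is taken in \<open>ereal\<close>, so that no boundedness is presupposed.\<close>

definition Lp_modulus :: "real \<Rightarrow> real \<Rightarrow> (real ^ 'd \<Rightarrow> complex) \<Rightarrow> ereal" where
  "Lp_modulus p \<delta> f =
     (SUP h\<in>{h. torus_abs h \<le> \<delta>}. ereal (torus_Lp_norm p (\<lambda>x. f (x + h) - f x)))"

definition freq_dot :: "int ^ 'd \<Rightarrow> real ^ 'd \<Rightarrow> real" where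
  "freq_dot k x = (\<Sum>j\<in>UNIV. of_int (k $ j) * x $ j)"

definition fourier_coeff :: "(real ^ 'd \<Rightarrow> complex) \<Rightarrow> int ^ 'd \<Rightarrow> complex" where
  "fourier_coeff f k =
     (LINT x|torus_measure. f x * exp (- (\<i> * complex_of_real (freq_dot k x))))"

definition rect_partial_sum :: "nat ^ 'd \<Rightarrow> (real ^ 'd \<Rightarrow> complex) \<Rightarrow> real ^ 'd \<Rightarrow> complex" where
  "rect_partial_sum n f x =
     (\<Sum>k\<in>{k. \<forall>j. \<bar>k $ j\<bar> \<le> int (n $ j)}.
        fourier_coeff f k * exp (\<i> * complex_of_real (freq_dot k x)))"

definition pringsheim :: "(nat ^ 'd) filter" where
  "pringsheim = filtercomap (\<lambda>n. MIN j. n $ j) at_top"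

lemma finite_freq_box: "finite {k :: int ^ 'd. \<forall>j. \<bar>k $ j\<bar> \<le> int (n $ j)}"
proof -
  have "{k :: int ^ 'd. \<forall>j. \<bar>k $ j\<bar> \<le> int (n $ j)} = {k. \<forall>j. k $ j \<in> {- int (n $ j)..int (n $ j)}}"
    by (auto simp: abs_le_iff) (smt (verit))+
  also have "finite \<dots>"
  proof -
    let ?P = "PiE UNIV (\<lambda>j. {- int (n $ j)..int (n $ j)})"
    have "{k :: int ^ 'd. \<forall>j. k $ j \<in> {- int (n $ j)..int (n $ j)}} \<subseteq> vec_lambda ` ?P"
      by (auto intro!: image_eqI[where x = "\<lambda>j. _ $ j"] simp: PiE_def)
    thus ?thesis by (rule finite_subset) (intro finite_imageI finite_PiE; simp)
  qed
  finally show ?thesis .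
qed

lemma torus_measure_space: "emeasure (torus_measure :: (real ^ 'd) measure) UNIV = 1"
proof -
  let ?Q = "{x :: real ^ 'd. \<forall>j. 0 \<le> x $ j \<and> x $ j < 2 * pi}"
  let ?c = "cbox 0 (\<chi> j. 2 * pi) :: (real ^ 'd) set"
  let ?b = "box 0 (\<chi> j. 2 * pi) :: (real ^ 'd) set"
  have Qs: "?Q \<in> sets borel" by measurable
  have "?c \<noteq> {}" by (auto simp: cbox_interval less_eq_vec_def)
  hence "measure lborel ?c = (2 * pi) ^ CARD('d)" by (simp add: content_cbox_cart)
  moreover have "emeasure lborel ?c = ennreal (measure lborel ?c)"
    using emeasure_lborel_cbox_finite by (intro emeasure_eq_ennreal_measure) (auto simp: less_top)
  ultimately have v1: "emeasure lborel ?c = ennreal ((2 * pi) ^ CARD('d))" by simp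
  hence v2: "emeasure lborel ?b = ennreal ((2 * pi) ^ CARD('d))"
    by (simp only: emeasure_lborel_cbox_eq emeasure_lborel_box_eq)
  note v = v1 v2
  have "emeasure lborel ?Q \<le> emeasure lborel ?c" "emeasure lborel ?b \<le> emeasure lborel ?Q"
    using Qs by (auto intro!: emeasure_mono simp: mem_box_cart less_imp_le)
  hence Q: "emeasure lebesgue ?Q = ennreal ((2 * pi) ^ CARD('d))"
    using v Qs by (simp add: emeasure_completion)
  have "emeasure (torus_measure :: (real ^ 'd) measure) UNIV =
        (\<integral>\<^sup>+ x. ennreal (1 / (2 * pi) ^ CARD('d)) * indicator ?Q x \<partial>lebesgue)"
  proof -
    have "(\<lambda>x. ennreal (indicator ?Q x / (2 * pi) ^ CARD('d))) \<in> borel_measurable lebesgue"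
      using Qs by (intro measurable_compose[OF _ measurable_ennreal] borel_measurable_divide
          borel_measurable_indicator borel_measurable_const) auto
    thus ?thesis unfolding torus_measure_def
      by (subst emeasure_density) (auto intro!: nn_integral_cong simp: indicator_def)
  qed
  also have "\<dots> = ennreal (1 / (2 * pi) ^ CARD('d)) * emeasure lebesgue ?Q"
    using Qs by (intro nn_integral_cmult_indicator) auto
  also have "\<dots> = 1"
    unfolding Q by (subst ennreal_mult[symmetric]) auto
  finally show ?thesis .
qed

end

theory Submission
  imports Defs "HOL-Real_Asymp.Real_Asymp"
begin

text \<open>
  For polynomials of degree \<open>N\<close> the maximal operator over all rectangular partial sums is controlled by
  duality. Linearizing the maximum by a measurable choice of \<open>n(x)\<close> and passing to the adjoint
  (Kolmogorov, Seliverstov, Plessner), the integral of the maximum of \<open>S_n g\<close> equals the pairing of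
  \<open>g\<close> with a function \<open>\<Phi>\<close>. Both \<open>sup |\<Phi>|\<close> and the integral of \<open>|\<Phi>|^2\<close> are at most \<open>M\<close>, the \<open>L^1\<close> norm of the product
  of the maximal one-dimensional Dirichlet kernels, which is of order \<open>(log N)^d\<close>. Hence the integral of the
  maximum is at most \<open>2 M^(1/p)\<close> times the \<open>L^p\<close> norm of \<open>g\<close>, for every \<open>p\<close> in \<open>[1, 2]\<close> at once.

  Let \<open>P_j\<close> be the Fejer mean of \<open>f\<close> of degree \<open>2^(4 * 2^j)\<close>. Its distance from \<open>f\<close> is bounded by the
  modulus at \<open>2^(- 2^j)\<close> up to a doubly exponentially small tail, so the maximal function of \<open>P_(j+1) - P_j\<close> has
  integral of order \<open>1 / (j (log j)^(1+\<eta>))\<close>. The sum over \<open>j\<close> is finite, and the partial sums of \<open>f\<close>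
  follow \<open>P_J\<close> up to the tail of an almost everywhere convergent series.
\<close>

section \<open>Haar measure on the torus\<close>

text \<open>The square integral of \<Phi> is bounded by the first power of \<open>M\<close> because
  composing two partial sum operators gives another one, with sides min(n_j, m_j): the linearized
  operator times its adjoint has no larger kernel than the operator itself. Interpolating this with
  the bound on sup |\<Phi>| produces the exponent 1/p.

  The degrees grow doubly exponentially so that their logarithms grow like 2^j and neighbouring
  blocks have comparable logarithms. One maximal estimate then serves a whole block, the power
  (log(1/\<delta>))^(d/p) of the hypothesis cancels \<open>M^(1/p)\<close> up to a constant, and the
  iterated logarithms that remain behave like j and log j.

  Two obstacles shape the details. The error of a Fejer mean is never measured in an L^p norm, which
  would call for Minkowski's integral inequality; it is estimated inside the pairing with a weight,
  where Fubini suffices. And \<open>f\<close> is only Lebesgue measurable, while Fubini wants Borel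
  functions of two variables; so the analysis is carried out for a periodic Borel version of
  \<open>f\<close>.\<close>

definition cell :: "(real ^ 'd) set" where
  "cell = {x. \<forall>j. 0 \<le> x $ j \<and> x $ j < 2 * pi}"

text \<open>The density lives on the Borel sets, not on their completion, so that Fubini and
  push-forwards under Borel maps apply directly.\<close>

definition haar :: "(real ^ 'd) measure" where
  "haar = density lborel (\<lambda>x. ennreal (indicator cell x / (2 * pi) ^ CARD('d)))"

definition lattice_vec :: "int ^ 'd \<Rightarrow> real ^ 'd" where
  "lattice_vec k = (\<chi> j. 2 * pi * of_int (k $ j))"

text \<open>Reduction modulo the lattice to the representative in the fundamental cell. Composition
  with it makes any function periodic.\<close>

definition wrap :: "real ^ 'd \<Rightarrow> real ^ 'd" where
  "wrap x = (\<chi> j. x $ j - 2 * pi * of_int \<lfloor>x $ j / (2 * pi)\<rfloor>)"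

lemma torus_periodic_lattice:
  assumes f: "torus_periodic f"
  shows "f (x + lattice_vec k) = f x"
proof -
  have nat_mult: "f (x + of_nat m *\<^sub>R axis j (2 * pi)) = f x" for x j m
  proof (induction m arbitrary: x)
    case (Suc m)
    have "f (x + of_nat (Suc m) *\<^sub>R axis j (2 * pi)) =
          f ((x + of_nat m *\<^sub>R axis j (2 * pi)) + axis j (2 * pi))"
      by (simp add: scaleR_left_distrib add_ac)
    thus ?case using f Suc by (simp add: torus_periodic_def)
  qed simp
  have int_mult: "f (x + of_int m *\<^sub>R axis j (2 * pi)) = f x" for x j m
  proof (cases "m \<ge> 0")
    case True
    thus ?thesis using nat_mult[of x "nat m" j] by simp
  next
    case False
    thus ?thesis
      using nat_mult[of "x + of_int m *\<^sub>R axis j (2 * pi)" "nat (- m)" j]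
      by (simp add: add.assoc flip: scaleR_left_distrib)
  qed
  have "f (x + (\<Sum>j\<in>J. of_int (k $ j) *\<^sub>R axis j (2 * pi))) = f x" if "finite J" for J x
    using that
  proof (induction J arbitrary: x)
    case (insert j J)
    have "f (x + (\<Sum>j\<in>insert j J. of_int (k $ j) *\<^sub>R axis j (2 * pi))) =
          f ((x + of_int (k $ j) *\<^sub>R axis j (2 * pi)) + (\<Sum>j\<in>J. of_int (k $ j) *\<^sub>R axis j (2 * pi)))"
      using insert.hyps by (simp add: add_ac)
    thus ?case using insert.IH int_mult by simp
  qed simp
  from this[of UNIV x] have "f (x + (\<Sum>j\<in>UNIV. of_int (k $ j) *\<^sub>R axis j (2 * pi))) = f x"
    by simp
  moreover have "(\<Sum>j\<in>UNIV. of_int (k $ j) *\<^sub>R axis j (2 * pi)) = lattice_vec k"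
    by (simp add: vec_eq_iff lattice_vec_def axis_def if_distrib cong: if_cong)
  ultimately show ?thesis by simp
qed

lemma wrap_eq_add_lattice: "wrap x = x + lattice_vec (\<chi> j. - \<lfloor>x $ j / (2 * pi)\<rfloor>)"
  by (simp add: wrap_def lattice_vec_def vec_eq_iff)

lemma torus_periodic_wrap: "torus_periodic f \<Longrightarrow> f (wrap x) = f x"
  by (simp add: wrap_eq_add_lattice torus_periodic_lattice)

lemma floor_bounds_2pi:
  "2 * pi * of_int \<lfloor>t / (2 * pi)\<rfloor> \<le> t" "t - 2 * pi * of_int \<lfloor>t / (2 * pi)\<rfloor> < 2 * pi"
proof -
  define m where "m = real_of_int \<lfloor>t / (2 * pi)\<rfloor>"
  have "m \<le> t / (2 * pi)" "t / (2 * pi) < m + 1"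
    unfolding m_def by linarith+
  thus "2 * pi * of_int \<lfloor>t / (2 * pi)\<rfloor> \<le> t" "t - 2 * pi * of_int \<lfloor>t / (2 * pi)\<rfloor> < 2 * pi"
    unfolding m_def[symmetric] by (simp_all add: field_simps)
qed

lemma wrap_in_cell: "wrap x \<in> cell"
  by (simp add: wrap_def cell_def floor_bounds_2pi)

text \<open>The translates of the half-open cell tile the space: in each coordinate exactly one
  integer multiple of 2 pi brings the point back.\<close>

lemma shift_in_cell_unique:
  "x + lattice_vec k \<in> cell \<longleftrightarrow> k = (\<chi> j. - \<lfloor>x $ j / (2 * pi)\<rfloor>)"
proof
  assume L: "x + lattice_vec k \<in> cell"
  have "\<lfloor>x $ j / (2 * pi)\<rfloor> = - (k $ j)" for j
  proof (rule floor_unique)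
    have "0 \<le> x $ j + 2 * pi * of_int (k $ j)" "x $ j + 2 * pi * of_int (k $ j) < 2 * pi"
      using L by (auto simp: cell_def lattice_vec_def)
    thus "of_int (- (k $ j)) \<le> x $ j / (2 * pi)" "x $ j / (2 * pi) < of_int (- (k $ j)) + 1"
      by (simp_all add: field_simps)
  qed
  thus "k = (\<chi> j. - \<lfloor>x $ j / (2 * pi)\<rfloor>)" by (simp add: vec_eq_iff)
next
  assume "k = (\<chi> j. - \<lfloor>x $ j / (2 * pi)\<rfloor>)"
  thus "x + lattice_vec k \<in> cell" using wrap_in_cell[of x] by (simp add: wrap_eq_add_lattice)
qed

lemma wrap_cell: "x \<in> cell \<Longrightarrow> wrap x = x"
  using shift_in_cell_unique[of x 0] wrap_eq_add_lattice[of x]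
  by (simp add: lattice_vec_def zero_vec_def[symmetric])

lemma torus_periodic_comp_wrap: "torus_periodic (\<lambda>x. g (wrap x))"
proof -
  have "wrap (x + axis j (2 * pi)) = wrap x" for x :: "real ^ 'd" and j
    by (simp add: vec_eq_iff wrap_def axis_def add_divide_distrib algebra_simps)
  thus ?thesis unfolding torus_periodic_def by metis
qed

lemma wrap_measurable [measurable]: "wrap \<in> borel_measurable borel"
proof -
  have "(\<lambda>x. wrap x $ i) \<in> borel_measurable borel" for i
    unfolding wrap_def by simp
  thus ?thesis
    by (subst borel_measurable_euclidean_space) (auto simp: Basis_vec_def inner_axis)
qed

lemma sets_cell [measurable]: "cell \<in> sets borel"
  unfolding cell_def by measurable

lemma sets_haar [measurable_cong, simp]: "sets haar = sets borel"
  by (simp add: haar_def)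

lemma space_haar [simp]: "space haar = UNIV"
  by (simp add: haar_def)

lemma nn_integral_haar:
  fixes F :: "real ^ 'd \<Rightarrow> ennreal"
  assumes [measurable]: "F \<in> borel_measurable borel"
  shows "(\<integral>\<^sup>+x. F x \<partial>haar) = ennreal (1 / (2 * pi) ^ CARD('d)) * (\<integral>\<^sup>+x. F x * indicator cell x \<partial>lborel)"
proof -
  have "(\<integral>\<^sup>+x. F x \<partial>haar) =
      (\<integral>\<^sup>+x. ennreal (1 / (2 * pi) ^ CARD('d)) * (F x * indicator cell x) \<partial>lborel)"
    unfolding haar_def
    by (subst nn_integral_density) (auto intro!: nn_integral_cong simp: indicator_def)
  thus ?thesis by (simp add: nn_integral_cmult)
qed

lemma sum_lattice_cell:
  "(\<integral>\<^sup>+k. indicator cell (x + lattice_vec k) \<partial>count_space (UNIV :: (int ^ 'd) set)) = 1"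
proof -
  have "(\<integral>\<^sup>+k. indicator cell (x + lattice_vec k) \<partial>count_space (UNIV :: (int ^ 'd) set)) =
     (\<integral>\<^sup>+k. indicator {\<chi> j. - \<lfloor>x $ j / (2 * pi)\<rfloor>} k \<partial>count_space UNIV)"
    by (intro nn_integral_cong) (auto simp: indicator_def shift_in_cell_unique)
  also have "\<dots> = 1" by simp
  finally show ?thesis .
qed

lemma lattice_vec_uminus: "lattice_vec (- k) = - lattice_vec k"
  by (simp add: lattice_vec_def vec_eq_iff)

text \<open>
  Inserting \<open>sum_lattice_cell\<close> and moving each summand by its lattice vector exchanges the
  translated cell with the original one.
\<close>

lemma nn_integral_haar_shift:
  fixes F :: "real ^ 'd \<Rightarrow> ennreal"
  assumes F: "torus_periodic F" and [measurable]: "F \<in> borel_measurable borel"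
  shows "(\<integral>\<^sup>+x. F (x + h) \<partial>haar) = (\<integral>\<^sup>+x. F x \<partial>haar)"
proof -
  have shift: "(\<integral>\<^sup>+x. G (x + c) \<partial>lborel) = (\<integral>\<^sup>+x. G x \<partial>lborel)"
    if [measurable]: "G \<in> borel_measurable borel" for G :: "real ^ 'd \<Rightarrow> ennreal" and c
    by (subst (2) lborel_distr_plus[of c, symmetric]) (simp add: nn_integral_distr add.commute)
  define cnt where "cnt = count_space (UNIV :: (int ^ 'd) set)"
  have "(\<integral>\<^sup>+x. F (x + h) * indicator cell x \<partial>lborel) = (\<integral>\<^sup>+x. F x * indicator cell (x - h) \<partial>lborel)"
    by (subst shift[of _ h, symmetric]) auto
  also have "\<dots> = (\<integral>\<^sup>+x. \<integral>\<^sup>+k. F x * indicator cell (x - h) * indicator cell (x + lattice_vec k) \<partial>cnt \<partial>lborel)"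
    by (simp add: nn_integral_cmult sum_lattice_cell cnt_def)
  also have "\<dots> = (\<integral>\<^sup>+k. \<integral>\<^sup>+x. F x * indicator cell (x - h) * indicator cell (x + lattice_vec k) \<partial>lborel \<partial>cnt)"
    unfolding cnt_def by (intro nn_integral_count_space_nn_integral) auto
  also have "\<dots> = (\<integral>\<^sup>+k. \<integral>\<^sup>+x. F x * indicator cell x * indicator cell ((x - h) + lattice_vec (- k)) \<partial>lborel \<partial>cnt)"
  proof (rule nn_integral_cong)
    fix k
    have F_lattice: "F (x - lattice_vec k) = F x" for x
      using torus_periodic_lattice[OF F, of x "- k"] by (simp add: lattice_vec_uminus)
    show "(\<integral>\<^sup>+x. F x * indicator cell (x - h) * indicator cell (x + lattice_vec k) \<partial>lborel) =
      (\<integral>\<^sup>+x. F x * indicator cell x * indicator cell ((x - h) + lattice_vec (- k)) \<partial>lborel)"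
      by (subst shift[of _ "lattice_vec (- k)", symmetric])
        (auto intro!: nn_integral_cong simp: lattice_vec_uminus F_lattice algebra_simps)
  qed
  also have "\<dots> = (\<integral>\<^sup>+x. \<integral>\<^sup>+k. F x * indicator cell x * indicator cell ((x - h) + lattice_vec (- k)) \<partial>cnt \<partial>lborel)"
    unfolding cnt_def by (intro nn_integral_count_space_nn_integral[symmetric]) auto
  also have "\<dots> = (\<integral>\<^sup>+x. F x * indicator cell x \<partial>lborel)"
  proof (intro nn_integral_cong)
    fix x
    have "(\<integral>\<^sup>+k. indicator cell ((x - h) + lattice_vec (- k)) \<partial>cnt) =
          (\<integral>\<^sup>+k. indicator cell ((x - h) + lattice_vec k) \<partial>cnt)"
      unfolding cnt_def
      by (rule nn_integral_bij_count_space[where g = uminus]) (auto intro!: bij_uminus simp: inj_on_def)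
    also have "\<dots> = 1" unfolding cnt_def by (rule sum_lattice_cell)
    finally show "(\<integral>\<^sup>+k. F x * indicator cell x * indicator cell ((x - h) + lattice_vec (- k)) \<partial>cnt) = F x * indicator cell x"
      by (simp add: nn_integral_cmult cnt_def)
  qed
  finally show ?thesis by (simp add: nn_integral_haar)
qed

text \<open>Translation invariance as an identity of measures, from which Bochner integrals inherit
  it by push-forward. The reduction \<open>wrap\<close> appears because \<open>haar\<close> is
  concentrated on the cell, which a translation leaves; under a periodic function it
  disappears.\<close>

lemma haar_shift: "distr haar borel (\<lambda>x. wrap (x + h)) = haar"
proof (rule measure_eqI)
  fix A assume "A \<in> sets (distr haar borel (\<lambda>x. wrap (x + h)))"
  hence [measurable]: "A \<in> sets borel" by simp
  have "emeasure (distr haar borel (\<lambda>x. wrap (x + h))) A =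
        (\<integral>\<^sup>+x. indicator A (wrap (x + h)) \<partial>haar)"
    by (subst nn_integral_distr[symmetric, of _ _ borel]) simp_all
  also have "\<dots> = (\<integral>\<^sup>+x. indicator A (wrap x) \<partial>haar)"
    by (rule nn_integral_haar_shift[OF torus_periodic_comp_wrap]) simp
  also have "\<dots> = (\<integral>\<^sup>+x. indicator A x \<partial>haar)"
    by (subst (1 2) nn_integral_haar, simp, simp, rule arg_cong[where f = "(*) _"])
      (auto intro!: nn_integral_cong simp: indicator_def wrap_cell)
  finally show "emeasure (distr haar borel (\<lambda>x. wrap (x + h))) A = emeasure haar A"
    by simp
qed simp

lemma
  fixes f :: "real ^ 'd \<Rightarrow> complex"
  assumes f: "torus_periodic f" and [measurable]: "f \<in> borel_measurable borel"
  shows integral_haar_shift: "(LINT x|haar. f (x + h)) = (LINT x|haar. f x)"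
    and integrable_haar_shift: "integrable haar (\<lambda>x. f (x + h)) \<longleftrightarrow> integrable haar f"
proof -
  have eq: "(\<lambda>x. f (x + h)) = (\<lambda>x. f (wrap (x + h)))"
    using torus_periodic_wrap[OF f] by simp
  show "(LINT x|haar. f (x + h)) = (LINT x|haar. f x)"
    unfolding eq by (subst (2) haar_shift[of h, symmetric], subst integral_distr) auto
  show "integrable haar (\<lambda>x. f (x + h)) \<longleftrightarrow> integrable haar f"
    unfolding eq by (subst (2) haar_shift[of h, symmetric], subst integrable_distr_eq) auto
qed

lemma cnj_measurable [measurable]: "cnj \<in> borel_measurable borel"
  by (intro borel_measurable_continuous_onI continuous_intros)

section \<open>Comparison with the completed measure\<close>

lemma sets_torus_measure [simp]: "sets torus_measure = sets lebesgue"
  and space_torus_measure [simp]: "space torus_measure = UNIV"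
  by (simp_all add: torus_measure_def)

lemma emeasure_torus_measure:
  assumes "A \<in> sets borel"
  shows "emeasure torus_measure A = emeasure haar A"
proof -
  let ?w = "\<lambda>x :: real ^ 'd. ennreal (indicator cell x / (2 * pi) ^ CARD('d))"
  have w: "?w \<in> borel_measurable borel" by measurable
  have "emeasure torus_measure A = (\<integral>\<^sup>+x. ?w x * indicator A x \<partial>lebesgue)"
    unfolding torus_measure_def cell_def[symmetric]
    using w assms by (subst emeasure_density) (auto intro: measurable_completion)
  also have "\<dots> = (\<integral>\<^sup>+x. ?w x * indicator A x \<partial>lborel)"
    using w assms by (intro nn_integral_completion)
  also have "\<dots> = emeasure haar A"
    unfolding haar_def using w assms by (subst emeasure_density) auto
  finally show ?thesis .
qed

lemma emeasure_haar_UNIV [simp]: "emeasure (haar :: (real ^ 'd) measure) UNIV = 1"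
  using emeasure_torus_measure[of "UNIV :: (real ^ 'd) set"] torus_measure_space[where 'd = 'd] by simp

interpretation haar: finite_measure haar
  by (rule finite_measureI) simp

interpretation haar_pair: pair_sigma_finite haar haar ..

lemma measure_haar_UNIV [simp]: "measure haar UNIV = 1"
  by (simp add: measure_def)

text \<open>The identity, seen as a map from the completed sigma-algebra to the Borel one, carries
  one measure to the other; integrals of Borel functions then agree by change of variables.\<close>

lemma haar_eq_distr_torus_measure: "haar = distr torus_measure borel (\<lambda>x. x)"
proof (rule measure_eqI)
  fix A assume "A \<in> sets haar"
  moreover have "(\<lambda>x. x) \<in> measurable torus_measure borel"
    unfolding torus_measure_def by (auto intro!: measurable_completion)
  ultimately show "emeasure haar A = emeasure (distr torus_measure borel (\<lambda>x. x)) A"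
    by (subst emeasure_distr) (auto simp: emeasure_torus_measure)
qed simp

lemma
  fixes g :: "real ^ 'd \<Rightarrow> 'b :: {banach, second_countable_topology}"
  assumes [measurable]: "g \<in> borel_measurable borel"
  shows integral_torus_measure: "(LINT x|torus_measure. g x) = (LINT x|haar. g x)"
    and integrable_torus_measure: "integrable torus_measure g \<longleftrightarrow> integrable haar g"
proof -
  have [measurable]: "(\<lambda>x. x) \<in> measurable torus_measure borel"
    unfolding torus_measure_def by (auto intro!: measurable_completion)
  show "(LINT x|torus_measure. g x) = (LINT x|haar. g x)"
    unfolding haar_eq_distr_torus_measure by (subst integral_distr) auto
  show "integrable torus_measure g \<longleftrightarrow> integrable haar g"
    unfolding haar_eq_distr_torus_measure by (subst integrable_distr_eq) auto
qed

lemma AE_torus_measure_if_AE_haar: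
  assumes "AE x in haar. P x"
  shows "AE x in torus_measure. P x"
proof -
  obtain N where "{x \<in> space haar. \<not> P x} \<subseteq> N" "N \<in> sets haar" "emeasure haar N = 0"
    using assms by (auto elim: AE_E)
  thus ?thesis
    by (intro AE_I[of _ _ N]) (auto simp: emeasure_torus_measure)
qed

section \<open>Characters and trigonometric polynomials\<close>

definition chr :: "int ^ 'd \<Rightarrow> real ^ 'd \<Rightarrow> complex" where
  "chr k x = exp (\<i> * complex_of_real (freq_dot k x))"

lemma chr_prod: "chr k x = (\<Prod>j\<in>UNIV. exp (\<i> * (of_int (k $ j) * complex_of_real (x $ j))))"
  by (simp add: chr_def freq_dot_def sum_distrib_left flip: exp_sum)

lemma chr_add_left: "chr (k + l) x = chr k x * chr l x"
  by (simp add: chr_def freq_dot_def algebra_simps sum.distrib flip: exp_add)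

lemma chr_add_right: "chr k (x + y) = chr k x * chr k y"
  by (simp add: chr_def freq_dot_def algebra_simps sum.distrib flip: exp_add)

lemma chr_zero [simp]: "chr 0 x = 1"
  by (simp add: chr_def freq_dot_def)

lemma norm_chr [simp]: "norm (chr k x) = 1"
  by (simp add: chr_def)

lemma chr_uminus_left: "chr (- k) x = cnj (chr k x)"
  by (simp add: chr_def freq_dot_def exp_cnj sum_negf)

lemma chr_uminus_right: "chr k (- x) = cnj (chr k x)"
  by (simp add: chr_def freq_dot_def exp_cnj sum_negf)

lemma chr_diff_left: "chr (k - l) x = chr k x * cnj (chr l x)"
  using chr_add_left[of k "- l" x] by (simp add: chr_uminus_left)

lemma chr_diff_right: "chr k (x - y) = chr k x * cnj (chr k y)"
  using chr_add_right[of k x "- y"] by (simp add: chr_uminus_right)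

lemma chr_mult_cnj [simp]: "chr k x * cnj (chr k x) = 1"
  by (simp add: complex_norm_square[symmetric])

lemma torus_periodic_chr: "torus_periodic (chr k)"
proof -
  have "chr k (axis j (2 * pi)) = 1" for j
  proof -
    have "freq_dot k (axis j (2 * pi)) = 2 * pi * of_int (k $ j)"
      by (simp add: freq_dot_def axis_def if_distrib cong: if_cong)
    thus ?thesis by (auto simp: chr_def exp_eq_1)
  qed
  thus ?thesis by (simp add: torus_periodic_def chr_add_right)
qed

lemma chr_measurable [measurable]: "chr k \<in> borel_measurable borel"
proof -
  have "continuous_on UNIV (chr k)"
    unfolding chr_def freq_dot_def by (intro continuous_intros)
  thus ?thesis by (rule borel_measurable_continuous_onI)
qed

lemma integrable_chr [simp]: "integrable haar (chr k)"
  by (rule haar.integrable_const_bound[where B = 1]) auto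

lemma integrable_mult_chr [simp]:
  assumes "integrable haar g"
  shows "integrable haar (\<lambda>x. g x * chr k x)" "integrable haar (\<lambda>x. chr k x * g x)"
    "integrable haar (\<lambda>x. g x * cnj (chr k x))"
proof -
  have [measurable]: "g \<in> borel_measurable haar" by (rule borel_measurable_integrable[OF assms])
  show "integrable haar (\<lambda>x. g x * chr k x)" "integrable haar (\<lambda>x. chr k x * g x)"
    "integrable haar (\<lambda>x. g x * cnj (chr k x))"
    by (rule Bochner_Integration.integrable_bound[OF assms]; simp add: norm_mult)+
qed

text \<open>Translation by a point where the character is \<open>-1\<close> negates the integral.\<close>

lemma integral_chr: "(LINT x|haar. chr k x) = (if k = 0 then 1 else 0)"
proof (cases "k = 0")
  case True
  thus ?thesis by simp
next
  case False
  then obtain j where j: "k $ j \<noteq> 0" by (auto simp: vec_eq_iff)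
  define h :: "real ^ 'a" where "h = axis j (pi / of_int (k $ j))"
  have "freq_dot k h = pi"
    using j by (simp add: freq_dot_def h_def axis_def if_distrib cong: if_cong)
  hence "chr k h = -1" by (simp add: chr_def)
  hence "(LINT x|haar. chr k (x + h)) = - (LINT x|haar. chr k x)"
    by (simp add: chr_add_right)
  thus ?thesis
    using integral_haar_shift[OF torus_periodic_chr chr_measurable, of k h] False by simp
qed

definition freq_box :: "nat ^ 'd \<Rightarrow> (int ^ 'd) set" where
  "freq_box n = {k. \<forall>j. \<bar>k $ j\<bar> \<le> int (n $ j)}"

lemma finite_freq_box_set [simp]: "finite (freq_box n)"
  unfolding freq_box_def by (rule finite_freq_box)

lemma fourier_coeff_haar:
  assumes [measurable]: "g \<in> borel_measurable borel"
  shows "fourier_coeff g k = (LINT x|haar. g x * cnj (chr k x))"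
proof -
  have "fourier_coeff g k = (LINT x|torus_measure. g x * cnj (chr k x))"
    by (simp add: fourier_coeff_def chr_def exp_cnj)
  also have "\<dots> = (LINT x|haar. g x * cnj (chr k x))"
    by (rule integral_torus_measure) measurable
  finally show ?thesis .
qed

lemma rect_partial_sum_chr: "rect_partial_sum n g x = (\<Sum>k\<in>freq_box n. fourier_coeff g k * chr k x)"
  by (simp add: rect_partial_sum_def freq_box_def chr_def)

lemma fourier_coeff_diff:
  assumes "g \<in> borel_measurable borel" "integrable haar g"
    and "h \<in> borel_measurable borel" "integrable haar h"
  shows "fourier_coeff (\<lambda>x. g x - h x) k = fourier_coeff g k - fourier_coeff h k"
  using assms by (simp add: fourier_coeff_haar left_diff_distrib)

lemma rect_partial_sum_diff:
  assumes "g \<in> borel_measurable borel" "integrable haar g"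
    and "h \<in> borel_measurable borel" "integrable haar h"
  shows "rect_partial_sum n (\<lambda>x. g x - h x) x = rect_partial_sum n g x - rect_partial_sum n h x"
  using assms by (simp add: rect_partial_sum_chr fourier_coeff_diff left_diff_distrib sum_subtractf)

definition trig_poly :: "nat \<Rightarrow> (real ^ 'd \<Rightarrow> complex) \<Rightarrow> bool" where
  "trig_poly K P \<longleftrightarrow> (\<exists>c. P = (\<lambda>x. \<Sum>k\<in>freq_box (\<chi> j. K). c k * chr k x))"

lemma trig_poly_chr:
  assumes "k \<in> freq_box (\<chi> j. K)"
  shows "trig_poly K (chr k)"
  unfolding trig_poly_def
  by (rule exI[of _ "\<lambda>l. if l = k then 1 else 0"])
    (use assms in \<open>simp add: fun_eq_iff if_distrib[where f = "\<lambda>z. z * _"] cong: if_cong\<close>)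

lemma trig_poly_cmult:
  assumes "trig_poly K P"
  shows "trig_poly K (\<lambda>x. a * P x)"
proof -
  obtain c where "P = (\<lambda>x. \<Sum>k\<in>freq_box (\<chi> j. K). c k * chr k x)"
    using assms by (auto simp: trig_poly_def)
  thus ?thesis unfolding trig_poly_def
    by (intro exI[of _ "\<lambda>k. a * c k"]) (simp add: fun_eq_iff sum_distrib_left mult.assoc)
qed

lemma trig_poly_add:
  assumes "trig_poly K P" "trig_poly K R"
  shows "trig_poly K (\<lambda>x. P x + R x)"
proof -
  obtain c e where "P = (\<lambda>x. \<Sum>k\<in>freq_box (\<chi> j. K). c k * chr k x)"
    "R = (\<lambda>x. \<Sum>k\<in>freq_box (\<chi> j. K). e k * chr k x)"
    using assms by (auto simp: trig_poly_def)
  thus ?thesis unfolding trig_poly_def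
    by (intro exI[of _ "\<lambda>k. c k + e k"]) (simp add: fun_eq_iff sum.distrib algebra_simps)
qed

lemma trig_poly_sum:
  assumes "\<And>i. i \<in> I \<Longrightarrow> trig_poly K (P i)"
  shows "trig_poly K (\<lambda>x. \<Sum>i\<in>I. P i x)"
proof -
  have zero: "trig_poly K (\<lambda>x. 0)"
    unfolding trig_poly_def by (rule exI[of _ "\<lambda>_. 0"]) simp
  show ?thesis
    using assms by (induction I rule: infinite_finite_induct) (auto simp: zero trig_poly_add)
qed

lemma trig_poly_diff:
  "trig_poly K P \<Longrightarrow> trig_poly K R \<Longrightarrow> trig_poly K (\<lambda>x. P x - R x)"
  using trig_poly_add[of K P "\<lambda>x. (-1) * R x"] trig_poly_cmult[of K R "-1"] by simp

lemma trig_poly_mono: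
  assumes "trig_poly K P" "K \<le> L"
  shows "trig_poly L P"
proof -
  obtain c where c: "P = (\<lambda>x. \<Sum>k\<in>freq_box (\<chi> j. K). c k * chr k x)"
    using assms by (auto simp: trig_poly_def)
  have "k \<in> freq_box (\<chi> j. L)" if "k \<in> freq_box (\<chi> j. K)" for k :: "int ^ 'a"
    using that assms(2) by (fastforce simp: freq_box_def intro: order_trans)
  thus ?thesis unfolding c
    by (intro trig_poly_sum trig_poly_cmult trig_poly_chr)
qed

lemma trig_poly_measurable: "trig_poly K P \<Longrightarrow> P \<in> borel_measurable borel"
  by (auto simp: trig_poly_def)

lemma trig_poly_integrable: "trig_poly K P \<Longrightarrow> integrable haar P"
  by (auto simp: trig_poly_def)

lemma fourier_coeff_trig_poly:
  fixes k :: "int ^ 'd"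
  assumes P: "P = (\<lambda>x. \<Sum>k\<in>freq_box (\<chi> j. K). c k * chr k x)"
  shows "fourier_coeff P k = (if k \<in> freq_box (\<chi> j. K) then c k else 0)"
proof -
  have "fourier_coeff P k = (LINT x|haar. (\<Sum>l\<in>freq_box (\<chi> j. K). c l * chr (l - k) x))"
    unfolding P by (subst fourier_coeff_haar)
      (auto intro!: Bochner_Integration.integral_cong simp: sum_distrib_right mult.assoc
        simp flip: chr_diff_left)
  also have "\<dots> = (\<Sum>l\<in>freq_box (\<chi> j. K). c l * (LINT x|haar. chr (l - k) x))"
    by (subst Bochner_Integration.integral_sum) auto
  also have "\<dots> = (if k \<in> freq_box (\<chi> j. K) then c k else 0)"
    by (simp add: integral_chr if_distrib cong: if_cong)
  finally show ?thesis .
qed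

text \<open>Coefficients beyond \<open>K\<close> vanish, so sides longer than \<open>K\<close> may
  be clipped. This is what lets a finite maximum over \<open>cube K\<close> dominate all partial
  sums of \<open>P\<close>.\<close>

lemma rect_partial_sum_trig_poly_min:
  assumes "trig_poly K P"
  shows "rect_partial_sum n P x = rect_partial_sum (\<chi> j. min (n $ j) K) P x"
proof -
  obtain c where c: "P = (\<lambda>x. \<Sum>k\<in>freq_box (\<chi> j. K). c k * chr k x)"
    using assms by (auto simp: trig_poly_def)
  have sub: "freq_box (\<chi> j. min (n $ j) K) \<subseteq> freq_box n"
    by (auto simp: freq_box_def of_nat_min)
  have zero: "fourier_coeff P k = 0" if "k \<in> freq_box n - freq_box (\<chi> j. min (n $ j) K)" for k
  proof -
    have "k \<notin> freq_box (\<chi> j. K)" using that by (fastforce simp: freq_box_def min_def split: if_splits)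
    thus ?thesis by (simp add: fourier_coeff_trig_poly[OF c])
  qed
  show ?thesis
    unfolding rect_partial_sum_chr by (rule sum.mono_neutral_right) (use sub zero in auto)
qed

lemma rect_partial_sum_trig_poly:
  assumes "trig_poly K P" "\<And>j. K \<le> n $ j"
  shows "rect_partial_sum n P x = P x"
proof -
  obtain c where c: "P = (\<lambda>x. \<Sum>k\<in>freq_box (\<chi> j. K). c k * chr k x)"
    using assms by (auto simp: trig_poly_def)
  have "(\<chi> j. min (n $ j) K) = (\<chi> j. K)" using assms(2) by (simp add: vec_eq_iff min_def antisym)
  hence "rect_partial_sum n P x = rect_partial_sum (\<chi> j. K) P x"
    by (subst rect_partial_sum_trig_poly_min[OF assms(1)]) simp
  also have "\<dots> = P x"
    by (subst rect_partial_sum_chr, subst (2) c) (auto intro!: sum.cong simp: fourier_coeff_trig_poly[OF c])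
  finally show ?thesis .
qed

section \<open>Maximal Dirichlet kernels\<close>

text \<open>One notion for both kernels: symmetric intervals give the Dirichlet kernels, and the
  squared modulus for \<open>{0..<K}\<close>, divided by \<open>K\<close>, is the Fejer
  kernel.\<close>

definition exp_sum_over :: "int set \<Rightarrow> real \<Rightarrow> complex" where
  "exp_sum_over A t = (\<Sum>a\<in>A. exp (\<i> * (of_int a * complex_of_real t)))"

lemma sum_chr_box:
  fixes A :: "'d::finite \<Rightarrow> int set"
  assumes A: "\<And>j. finite (A j)"
  shows "(\<Sum>k | \<forall>j. k $ j \<in> A j. chr k x) = (\<Prod>j\<in>UNIV. exp_sum_over (A j) (x $ j))"
proof -
  have "(\<Prod>j\<in>UNIV. exp_sum_over (A j) (x $ j)) =
        (\<Sum>g\<in>PiE UNIV A. \<Prod>j\<in>UNIV. exp (\<i> * (of_int (g j) * complex_of_real (x $ j))))"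
    unfolding exp_sum_over_def using A by (intro prod_sum_PiE) auto
  also have "\<dots> = (\<Sum>k | \<forall>j. k $ j \<in> A j. chr k x)"
    by (rule sum.reindex_bij_witness[of _ vec_nth vec_lambda]) (auto simp: PiE_def chr_prod)
  finally show ?thesis ..
qed

lemma exp_sum_over_measurable [measurable]: "exp_sum_over A \<in> borel_measurable borel"
  unfolding exp_sum_over_def by (intro borel_measurable_continuous_onI continuous_intros)

lemma norm_exp_sum_over_le: "norm (exp_sum_over A t) \<le> card A"
  unfolding exp_sum_over_def by (rule order_trans[OF norm_sum]) (simp add: norm_exp_eq_Re)

lemma exp_sum_over_periodic: "exp_sum_over A (t + 2 * pi) = exp_sum_over A t"
proof -
  have "exp (\<i> * (of_int a * complex_of_real (t + 2 * pi))) = exp (\<i> * (of_int a * complex_of_real t))" for a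
  proof -
    have "exp (\<i> * (of_int a * complex_of_real (t + 2 * pi))) =
          exp (\<i> * (of_int a * complex_of_real t)) * exp (of_int (2 * a) * (of_real pi * \<i>))"
      by (simp add: algebra_simps flip: exp_add)
    also have "exp (of_int (2 * a) * (of_real pi * \<i>)) = 1"
      by (subst exp_eq_1) auto
    finally show ?thesis by simp
  qed
  thus ?thesis by (simp add: exp_sum_over_def)
qed

text \<open>Jordan's inequality: a concave function lies above its chord.\<close>

lemma sin_ge_linear:
  assumes "0 \<le> x" "x \<le> pi / 2"
  shows "2 * x / pi \<le> sin x"
proof -
  have cvx: "convex_on {0..pi / 2} (\<lambda>x. - sin x)"
    by (rule f''_ge0_imp_convex[where f' = "\<lambda>x. - cos x" and f'' = sin])
      (auto intro!: derivative_eq_intros sin_ge_zero)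
  have "- sin ((1 - 2 * x / pi) *\<^sub>R 0 + (2 * x / pi) *\<^sub>R (pi / 2)) \<le>
        (1 - 2 * x / pi) * (- sin 0) + (2 * x / pi) * (- sin (pi / 2))"
    by (rule convex_onD[OF cvx]) (use assms in \<open>auto simp: field_simps\<close>)
  thus ?thesis by simp
qed

text \<open>The norm is the chord length 2 sin(t/2); the reflection of t to 2 pi - t reduces the
  second half of the period to Jordan's inequality.\<close>

lemma norm_exp_i_minus_1_ge:
  assumes "0 \<le> t" "t \<le> 2 * pi"
  shows "2 * min t (2 * pi - t) / pi \<le> norm (exp (\<i> * of_real t) - 1)"
proof (cases "t \<le> pi")
  case True
  thus ?thesis
    using sin_ge_linear[of "t / 2"] assms by (auto simp: dist_exp_i_1)
next
  case False
  have "sin (t / 2) = sin ((2 * pi - t) / 2)"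
    by (subst sin_pi_minus[symmetric]) (simp add: field_simps)
  thus ?thesis
    using False sin_ge_linear[of "(2 * pi - t) / 2"] assms by (auto simp: dist_exp_i_1)
qed

text \<open>The geometric sum telescopes after multiplication by its denominator. Keeping that
  factor on the left includes the points where it vanishes.\<close>

lemma norm_exp_sum_over_geometric:
  assumes "a \<le> b"
  shows "norm (exp_sum_over {a..<b} t) * norm (exp (\<i> * of_real t) - 1) \<le> 2"
proof -
  let ?e = "\<lambda>a :: int. exp (\<i> * (of_int a * complex_of_real t))"
  have "exp_sum_over {a..<b} t * (exp (\<i> * of_real t) - 1) = ?e b - ?e a"
    using assms
  proof (induction b rule: int_ge_induct)
    case (step b)
    have "{a..<b + 1} = insert b {a..<b}" using step by auto
    hence "exp_sum_over {a..<b + 1} t = ?e b + exp_sum_over {a..<b} t"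
      by (simp add: exp_sum_over_def)
    moreover have "?e (b + 1) = ?e b * exp (\<i> * of_real t)"
      by (simp add: algebra_simps flip: exp_add)
    ultimately show ?case using step.IH by (simp add: algebra_simps)
  qed (simp add: exp_sum_over_def)
  hence "norm (exp_sum_over {a..<b} t) * norm (exp (\<i> * of_real t) - 1) = norm (?e b - ?e a)"
    by (metis norm_mult)
  also have "\<dots> \<le> norm (?e b) + norm (?e a)" by (rule norm_triangle_ineq4)
  also have "\<dots> = 2" by (simp add: norm_exp_eq_Re)
  finally show ?thesis .
qed

lemma norm_exp_sum_over_min:
  assumes "a \<le> b" "0 \<le> t" "t \<le> 2 * pi"
  shows "norm (exp_sum_over {a..<b} t) * min t (2 * pi - t) \<le> pi"
proof -
  have "norm (exp_sum_over {a..<b} t) * (2 * min t (2 * pi - t) / pi) \<le> 2"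
    using mult_left_mono[OF norm_exp_i_minus_1_ge[OF assms(2,3)], of "norm (exp_sum_over {a..<b} t)"]
      norm_exp_sum_over_geometric[OF assms(1), of t] by simp
  thus ?thesis by (simp add: field_simps)
qed

text \<open>The sides of a rectangle vary independently, so the maximum is taken in each variable
  separately; it still costs only one logarithm per variable.\<close>

definition dirichlet_max :: "nat \<Rightarrow> real \<Rightarrow> real" where
  "dirichlet_max N t = Max ((\<lambda>m. norm (exp_sum_over {- int m..int m} t)) ` {..N})"

lemma dirichlet_max_measurable [measurable]: "dirichlet_max N \<in> borel_measurable borel"
  unfolding dirichlet_max_def by measurable

lemma dirichlet_max_ge: "m \<le> N \<Longrightarrow> norm (exp_sum_over {- int m..int m} t) \<le> dirichlet_max N t"
  unfolding dirichlet_max_def by (intro Max_ge) auto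

lemma dirichlet_max_nonneg [simp]: "0 \<le> dirichlet_max N t"
  using dirichlet_max_ge[of 0 N t] norm_ge_zero order_trans by blast

lemma dirichlet_max_periodic: "dirichlet_max N (t + 2 * pi) = dirichlet_max N t"
  by (simp add: dirichlet_max_def exp_sum_over_periodic)

text \<open>With s the distance of t to the lattice, counting terms gives |D| \<le> a and the
  geometric sum gives |D| s \<le> pi. Together |D| (s + pi / a) \<le> 2 pi, uniformly in the order
  of the kernel. Replacing the minimum in s by the sum of both alternatives leaves a function with
  an elementary primitive.\<close>

lemma dirichlet_max_le:
  assumes t: "0 \<le> t" "t \<le> 2 * pi"
    and a_def: "a = 2 * real N + 1"
  shows "dirichlet_max N t \<le> 2 * pi / (t + pi / a) + 2 * pi / (2 * pi - t + pi / a)"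
proof -
  have a: "a > 0" by (simp add: a_def)
  define s where "s = min t (2 * pi - t)"
  have s: "s \<ge> 0" using t by (simp add: s_def)
  have pos: "t + pi / a > 0" "2 * pi - t + pi / a > 0" "s + pi / a > 0"
    using t s a by (auto intro!: add_nonneg_pos)
  have "norm (exp_sum_over {- int m..int m} t) \<le> 2 * pi / (s + pi / a)" if "m \<le> N" for m
  proof -
    let ?D = "norm (exp_sum_over {- int m..int m} t)"
    have "{- int m..int m} = {- int m..<int m + 1}" by auto
    hence "?D * s \<le> pi"
      unfolding s_def using norm_exp_sum_over_min[of "- int m" "int m + 1" t] t by simp
    moreover have "?D \<le> a"
      using norm_exp_sum_over_le[of "{- int m..int m}" t] that by (simp add: a_def)
    hence "?D * (pi / a) \<le> pi" using a by (simp add: field_simps)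
    ultimately have "?D * (s + pi / a) \<le> 2 * pi" by (simp add: distrib_left)
    thus ?thesis using pos by (simp add: pos_le_divide_eq)
  qed
  hence "dirichlet_max N t \<le> 2 * pi / (s + pi / a)"
    unfolding dirichlet_max_def by (subst Max_le_iff) auto
  also have "\<dots> \<le> 2 * pi / (t + pi / a) + 2 * pi / (2 * pi - t + pi / a)"
    using pos by (auto simp: s_def min_def)
  finally show ?thesis .
qed

text \<open>The two summands of the pointwise bound integrate to logarithms of (2 pi + pi / a) / (pi
  / a) = 2 a + 1 = 4 N + 3, each with factor 2 pi; division by the length of the period leaves the
  factor 2.\<close>

lemma nn_integral_dirichlet_max:
  "ennreal (1 / (2 * pi)) * (\<integral>\<^sup>+t. ennreal (dirichlet_max N t) * indicator {0..<2 * pi} t \<partial>lborel)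
     \<le> ennreal (2 * ln (4 * real N + 3))"
proof -
  define a where "a = 2 * real N + 1"
  have a: "a > 0" by (simp add: a_def)
  define G where "G = (\<lambda>t. if 0 \<le> t \<and> t \<le> 2 * pi then 2 * pi / (t + pi / a) + 2 * pi / (2 * pi - t + pi / a) else 0)"
  have [measurable]: "G \<in> borel_measurable borel" unfolding G_def by measurable
  have "(\<integral>\<^sup>+t. ennreal (dirichlet_max N t) * indicator {0..<2 * pi} t \<partial>lborel) \<le>
        (\<integral>\<^sup>+t. ennreal (G t) * indicator {0..2 * pi} t \<partial>lborel)"
    using dirichlet_max_le[OF _ _ a_def]
    by (intro nn_integral_mono) (auto simp: indicator_def G_def intro!: ennreal_leI)
  also have "\<dots> = ennreal (2 * pi * (ln (2 * pi + pi / a) - ln (2 * pi - 2 * pi + pi / a))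
                         - 2 * pi * (ln (0 + pi / a) - ln (2 * pi - 0 + pi / a)))"
  proof (rule nn_integral_FTC_Icc)
    fix t :: real assume t: "t \<in> {0..2 * pi}"
    have pos: "t + pi / a > 0" "2 * pi - t + pi / a > 0"
      using t a by (auto intro!: add_nonneg_pos)
    show "((\<lambda>t. 2 * pi * (ln (t + pi / a) - ln (2 * pi - t + pi / a))) has_real_derivative G t) (at t)"
      by (rule derivative_eq_intros refl | use pos t in \<open>simp add: G_def field_simps\<close>)+
    show "0 \<le> G t" using pos t by (simp add: G_def)
  qed auto
  also have "2 * pi * (ln (2 * pi + pi / a) - ln (2 * pi - 2 * pi + pi / a))
                         - 2 * pi * (ln (0 + pi / a) - ln (2 * pi - 0 + pi / a)) =
             4 * pi * ln ((2 * pi + pi / a) / (pi / a))"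
  proof -
    have "2 * pi + pi / a > 0" "pi / a > 0" using a by (auto intro!: add_pos_pos)
    hence ln_eq: "ln ((2 * pi + pi / a) / (pi / a)) = ln (2 * pi + pi / a) - ln (pi / a)"
      by (rule ln_divide_pos)
    show ?thesis unfolding ln_eq by (simp add: algebra_simps)
  qed
  also have "(2 * pi + pi / a) / (pi / a) = 4 * real N + 3"
  proof -
    have "(2 * pi + pi / a) / (pi / a) = 2 * a + 1" using a by (simp add: field_simps)
    thus ?thesis by (simp add: a_def)
  qed
  finally have "(\<integral>\<^sup>+t. ennreal (dirichlet_max N t) * indicator {0..<2 * pi} t \<partial>lborel) \<le>
     ennreal (4 * pi * ln (4 * real N + 3))" .
  hence "ennreal (1 / (2 * pi)) * (\<integral>\<^sup>+t. ennreal (dirichlet_max N t) * indicator {0..<2 * pi} t \<partial>lborel)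
     \<le> ennreal (1 / (2 * pi)) * ennreal (4 * pi * ln (4 * real N + 3))"
    by (rule mult_left_mono) simp
  also have "\<dots> = ennreal (2 * ln (4 * real N + 3))"
    by (subst ennreal_mult[symmetric]) auto
  finally show ?thesis .
qed

lemma nn_integral_haar_prod:
  fixes \<phi> :: "real \<Rightarrow> ennreal"
  assumes [measurable]: "\<phi> \<in> borel_measurable borel"
  shows "(\<integral>\<^sup>+x. (\<Prod>j\<in>UNIV. \<phi> (x $ j)) \<partial>(haar :: (real ^ 'd) measure)) =
         (ennreal (1 / (2 * pi)) * (\<integral>\<^sup>+t. \<phi> t * indicator {0..<2 * pi} t \<partial>lborel)) ^ CARD('d)"
proof -
  have Basis: "(Basis :: (real ^ 'd) set) = (\<lambda>j. axis j 1) ` UNIV" by (auto simp: Basis_vec_def)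
  have inj: "inj (\<lambda>j :: 'd. axis j (1 :: real))" by (auto simp: inj_on_def axis_eq_axis)
  have prod_indicator: "(\<Prod>j\<in>UNIV. \<phi> (x $ j)) * indicator cell x =
      (\<Prod>b\<in>Basis. \<phi> (x \<bullet> b) * indicator {0..<2 * pi} (x \<bullet> b))" for x :: "real ^ 'd"
  proof -
    have "indicator cell x = (\<Prod>j\<in>UNIV. indicator {0..<2 * pi} (x $ j) :: ennreal)"
      by (auto simp: indicator_def cell_def)
    thus ?thesis
      unfolding Basis by (subst prod.reindex[OF inj]) (simp add: inner_axis prod.distrib)
  qed
  have "(\<integral>\<^sup>+x. (\<Prod>j\<in>UNIV. \<phi> (x $ j)) \<partial>(haar :: (real ^ 'd) measure)) =
        ennreal (1 / (2 * pi) ^ CARD('d)) * (\<Prod>b\<in>(Basis :: (real ^ 'd) set). \<integral>\<^sup>+t. \<phi> t * indicator {0..<2 * pi} t \<partial>lborel)"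
    by (subst nn_integral_haar) (simp_all add: prod_indicator
        nn_integral_lborel_prod[where f = "\<lambda>_ t. \<phi> t * indicator {0..<2 * pi} t"])
  also have "\<dots> = ennreal (1 / (2 * pi)) ^ CARD('d) * (\<integral>\<^sup>+t. \<phi> t * indicator {0..<2 * pi} t \<partial>lborel) ^ CARD('d)"
    by (simp add: ennreal_power power_one_over[symmetric] power_divide)
  finally show ?thesis by (simp add: power_mult_distrib)
qed

definition dirichlet_majorant :: "nat \<Rightarrow> real ^ 'd \<Rightarrow> real" where
  "dirichlet_majorant N x = (\<Prod>j\<in>UNIV. dirichlet_max N (x $ j))"

definition lebesgue_bound :: "nat \<Rightarrow> nat \<Rightarrow> real" where
  "lebesgue_bound d N = (2 * ln (4 * real N + 3)) ^ d"

text \<open>The summand 3 exceeds e, so the logarithm is at least 1 even for \<open>N = 0\<close>.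
  Being at least 1, the bound admits the constant weight 1 in the pairing estimates below.\<close>

lemma lebesgue_bound_ge_1: "1 \<le> lebesgue_bound d N"
proof -
  have "exp 1 \<le> 4 * real N + 3" using exp_le by linarith
  hence "1 \<le> ln (4 * real N + 3)" by (subst ln_ge_iff) auto
  thus ?thesis unfolding lebesgue_bound_def by (intro one_le_power) simp
qed

lemma dirichlet_majorant_measurable [measurable]: "dirichlet_majorant N \<in> borel_measurable borel"
  unfolding dirichlet_majorant_def by measurable

lemma dirichlet_majorant_nonneg [simp]: "0 \<le> dirichlet_majorant N x"
  unfolding dirichlet_majorant_def by (intro prod_nonneg) simp

lemma torus_periodic_dirichlet_majorant: "torus_periodic (dirichlet_majorant N)"
  unfolding torus_periodic_def dirichlet_majorant_def
  by (auto intro!: prod.cong simp: axis_def dirichlet_max_periodic)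

lemma norm_sum_chr_le_dirichlet_majorant:
  assumes "\<And>j. n $ j \<le> N"
  shows "norm (\<Sum>k\<in>freq_box n. chr k x) \<le> dirichlet_majorant N x"
proof -
  have "freq_box n = {k. \<forall>j. k $ j \<in> {- int (n $ j)..int (n $ j)}}"
    by (auto simp: freq_box_def abs_le_iff) (smt (verit))+
  hence "(\<Sum>k\<in>freq_box n. chr k x) = (\<Prod>j\<in>UNIV. exp_sum_over {- int (n $ j)..int (n $ j)} (x $ j))"
    using sum_chr_box[of "\<lambda>j. {- int (n $ j)..int (n $ j)}" x] by simp
  thus ?thesis
    unfolding dirichlet_majorant_def by (auto simp: prod_norm[symmetric] intro!: prod_mono dirichlet_max_ge assms)
qed

text \<open>The translate is included because the kernel is later taken at \<open>x - y\<close> with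
  \<open>y\<close> fixed.\<close>

lemma nn_integral_dirichlet_majorant:
  "(\<integral>\<^sup>+x. ennreal (dirichlet_majorant N (x + h)) \<partial>(haar :: (real ^ 'd) measure)) \<le> ennreal (lebesgue_bound CARD('d) N)"
proof -
  have "(\<integral>\<^sup>+x. ennreal (dirichlet_majorant N (x + h)) \<partial>(haar :: (real ^ 'd) measure)) =
        (\<integral>\<^sup>+x. ennreal (dirichlet_majorant N x) \<partial>(haar :: (real ^ 'd) measure))"
    using torus_periodic_dirichlet_majorant[of N, where 'a = 'd]
    by (intro nn_integral_haar_shift[where F = "\<lambda>x. ennreal (dirichlet_majorant N x)"])
      (auto simp: torus_periodic_def)
  also have "\<dots> = (\<integral>\<^sup>+x. (\<Prod>j\<in>UNIV. ennreal (dirichlet_max N (x $ j))) \<partial>(haar :: (real ^ 'd) measure))"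
    by (simp add: dirichlet_majorant_def prod_ennreal)
  also have "\<dots> \<le> ennreal (2 * ln (4 * real N + 3)) ^ CARD('d)"
    by (subst nn_integral_haar_prod) (auto intro!: power_mono nn_integral_dirichlet_max)
  also have "\<dots> = ennreal (lebesgue_bound CARD('d) N)"
    unfolding lebesgue_bound_def by (rule ennreal_power) simp
  finally show ?thesis .
qed

section \<open>The maximal operator by duality\<close>

text \<open>
  A measurable linearization of the maximum of finitely many functions: \<open>\<theta> n x\<close> vanishes unless
  \<open>n\<close> is the selected index at \<open>x\<close>, where it is the phase that makes \<open>u n x\<close> nonnegative.
\<close>

lemma measurable_max_selector:
  fixes u :: "'i \<Rightarrow> 'x \<Rightarrow> complex"
  assumes "finite B" and "\<And>n. n \<in> B \<Longrightarrow> u n \<in> borel_measurable M"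
  obtains \<theta> where "\<And>n. \<theta> n \<in> borel_measurable M"
    and "\<And>x. (\<Sum>n\<in>B. norm (\<theta> n x)) \<le> 1"
    and "\<And>x. (\<Sum>n\<in>B. \<theta> n x * u n x) = of_real (norm (\<Sum>n\<in>B. \<theta> n x * u n x))"
    and "\<And>x n. n \<in> B \<Longrightarrow> norm (u n x) \<le> norm (\<Sum>n\<in>B. \<theta> n x * u n x)"
proof -
  have "\<exists>\<theta>. (\<forall>n. \<theta> n \<in> borel_measurable M) \<and> (\<forall>x. (\<Sum>n\<in>B. norm (\<theta> n x)) \<le> 1) \<and>
      (\<forall>x. (\<Sum>n\<in>B. \<theta> n x * u n x) = of_real (norm (\<Sum>n\<in>B. \<theta> n x * u n x))) \<and>
      (\<forall>x. \<forall>n\<in>B. norm (u n x) \<le> norm (\<Sum>n\<in>B. \<theta> n x * u n x))"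
    using assms
  proof (induction B rule: finite_induct)
    case empty
    show ?case by (rule exI[of _ "\<lambda>_ _. 0"]) simp
  next
    case (insert m B)
    from insert.IH[OF insert.prems[OF insertI2]] obtain \<theta> where \<theta> [measurable]: "\<And>n. \<theta> n \<in> borel_measurable M"
      and le1: "\<And>x. (\<Sum>n\<in>B. norm (\<theta> n x)) \<le> 1"
      and nonneg: "\<And>x. (\<Sum>n\<in>B. \<theta> n x * u n x) = of_real (norm (\<Sum>n\<in>B. \<theta> n x * u n x))"
      and max: "\<And>x n. n \<in> B \<Longrightarrow> norm (u n x) \<le> norm (\<Sum>n\<in>B. \<theta> n x * u n x)"
      by blast
    define s where "s x = (\<Sum>n\<in>B. \<theta> n x * u n x)" for x
    have [measurable]: "u m \<in> borel_measurable M" using insert.prems by auto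
    have [measurable]: "s \<in> borel_measurable M" unfolding s_def
      using insert.prems by (intro borel_measurable_sum borel_measurable_times) auto
    \<comment> \<open>The new index \<open>m\<close> takes over exactly where it strictly beats the
      running maximum. This set is measurable, and \<open>u m x\<close> is nonzero on it, so the
      phase is well defined.\<close>
    define \<theta>' where "\<theta>' n x =
      (if norm (s x) < norm (u m x) then if n = m then cnj (u m x) / of_real (norm (u m x)) else 0
       else if n = m then 0 else \<theta> n x)" for n x
    have meas: "\<theta>' n \<in> borel_measurable M" for n
      unfolding \<theta>'_def by measurable
    have val: "(\<Sum>n\<in>insert m B. norm (\<theta>' n x)) \<le> 1 \<and>
       (\<Sum>n\<in>insert m B. \<theta>' n x * u n x) = of_real (max (norm (s x)) (norm (u m x)))" for x
    proof (cases "norm (s x) < norm (u m x)")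
      case True
      have B: "n \<noteq> m" if "n \<in> B" for n using that insert.hyps by auto
      have "u m x \<noteq> 0" using True by auto
      moreover have "cnj (u m x) * u m x = of_real (norm (u m x)) * of_real (norm (u m x))"
        by (metis complex_norm_square mult.commute of_real_mult power2_eq_square)
      ultimately show ?thesis
        using True insert.hyps by (simp add: \<theta>'_def B norm_divide max_def)
    next
      case False
      have B: "n \<noteq> m" if "n \<in> B" for n using that insert.hyps by auto
      have "(\<Sum>n\<in>insert m B. \<theta>' n x * u n x) = s x"
        using False insert.hyps by (simp add: \<theta>'_def B s_def)
      moreover have "(\<Sum>n\<in>insert m B. norm (\<theta>' n x)) = (\<Sum>n\<in>B. norm (\<theta> n x))"
        using False insert.hyps by (simp add: \<theta>'_def B)
      moreover have "of_real (norm (s x)) = s x"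
        unfolding s_def by (rule nonneg[symmetric])
      ultimately show ?thesis using False le1[of x] by (simp add: max_def)
    qed
    show ?case
    proof (intro exI[of _ \<theta>'] conjI allI ballI meas)
      fix x n
      show "(\<Sum>n\<in>insert m B. norm (\<theta>' n x)) \<le> 1" using val[of x] by simp
      show "(\<Sum>n\<in>insert m B. \<theta>' n x * u n x) = of_real (norm (\<Sum>n\<in>insert m B. \<theta>' n x * u n x))"
        using val[of x] by (simp add: max_def)
      assume "n \<in> insert m B"
      thus "norm (u n x) \<le> norm (\<Sum>n\<in>insert m B. \<theta>' n x * u n x)"
        using val[of x] max[of n x] by (auto simp: s_def)
    qed
  qed
  then obtain \<theta> where "(\<forall>n. \<theta> n \<in> borel_measurable M) \<and> (\<forall>x. (\<Sum>n\<in>B. norm (\<theta> n x)) \<le> 1) \<and>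
      (\<forall>x. (\<Sum>n\<in>B. \<theta> n x * u n x) = of_real (norm (\<Sum>n\<in>B. \<theta> n x * u n x))) \<and>
      (\<forall>x. \<forall>n\<in>B. norm (u n x) \<le> norm (\<Sum>n\<in>B. \<theta> n x * u n x))" ..
  thus ?thesis by (intro that[of \<theta>]) blast+
qed

definition cube :: "nat \<Rightarrow> (nat ^ 'd) set" where
  "cube N = {n. \<forall>j. n $ j \<le> N}"

lemma finite_cube [simp]: "finite (cube N :: (nat ^ 'd) set)"
proof -
  have "cube N \<subseteq> vec_lambda ` (PiE (UNIV :: 'd set) (\<lambda>_. {..N}))"
    by (auto intro!: image_eqI[where x = "\<lambda>j. _ $ j"] simp: PiE_def cube_def)
  thus ?thesis by (rule finite_subset) (intro finite_imageI finite_PiE; simp)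
qed

lemma cube_nonempty [simp]: "cube N \<noteq> {}"
proof -
  have "0 \<in> cube N" by (simp add: cube_def)
  thus ?thesis by blast
qed

definition max_partial_sum :: "nat \<Rightarrow> (real ^ 'd \<Rightarrow> complex) \<Rightarrow> real ^ 'd \<Rightarrow> real" where
  "max_partial_sum N g x = Max ((\<lambda>n. norm (rect_partial_sum n g x)) ` cube N)"

lemma rect_partial_sum_measurable [measurable]: "rect_partial_sum n g \<in> borel_measurable borel"
  unfolding rect_partial_sum_chr by measurable

lemma max_partial_sum_measurable [measurable]: "max_partial_sum N g \<in> borel_measurable borel"
  unfolding max_partial_sum_def by measurable

lemma max_partial_sum_ge: "n \<in> cube N \<Longrightarrow> norm (rect_partial_sum n g x) \<le> max_partial_sum N g x"
  unfolding max_partial_sum_def by (intro Max_ge) auto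

lemma max_partial_sum_nonneg [simp]: "0 \<le> max_partial_sum N g x"
  by (rule order_trans[OF norm_ge_zero max_partial_sum_ge[of 0]]) (simp add: cube_def)

text \<open>
  Used with \<open>r n = n\<close> for the adjoint of the linearized maximal operator, and with
  \<open>r n = min n m\<close> for the kernel of the operator composed with its adjoint.
\<close>

lemma linearized_kernel_bound:
  fixes \<theta> :: "'i \<Rightarrow> real ^ 'd \<Rightarrow> complex" and r :: "'i \<Rightarrow> nat ^ 'd"
  assumes [simp]: "\<And>n. integrable haar (\<theta> n)"
    and le1: "\<And>x. (\<Sum>n\<in>B. norm (\<theta> n x)) \<le> 1"
    and r: "\<And>n. n \<in> B \<Longrightarrow> r n \<in> cube N"
  shows "norm (\<Sum>n\<in>B. \<Sum>k\<in>freq_box (r n). (LINT x|haar. \<theta> n x * chr k x) * cnj (chr k y))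
           \<le> lebesgue_bound CARD('d) N"
proof -
  let ?I = "\<lambda>x. \<Sum>n\<in>B. \<theta> n x * (\<Sum>k\<in>freq_box (r n). chr k (x - y))"
  have eq: "?I = (\<lambda>x. \<Sum>n\<in>B. \<Sum>k\<in>freq_box (r n). (\<theta> n x * chr k x) * cnj (chr k y))"
    by (simp add: fun_eq_iff sum_distrib_left mult.assoc chr_diff_right)
  have int: "integrable haar ?I" unfolding eq by simp
  have "(\<Sum>n\<in>B. \<Sum>k\<in>freq_box (r n). (LINT x|haar. \<theta> n x * chr k x) * cnj (chr k y)) = (LINT x|haar. ?I x)"
    unfolding eq by simp
  also have "ennreal (norm \<dots>) \<le> (\<integral>\<^sup>+x. ennreal (norm (?I x)) \<partial>haar)"
    by (rule integral_norm_bound_ennreal[OF int])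
  also have "\<dots> \<le> (\<integral>\<^sup>+x. ennreal (dirichlet_majorant N (x + (- y))) \<partial>haar)"
  proof (intro nn_integral_mono ennreal_leI)
    fix x
    \<comment> \<open>The selected index may vary with \<open>x\<close> at no cost: one majorant
      dominates all kernels of the cube, and the weights at \<open>x\<close> sum to at most
      1.\<close>
    have "norm (?I x) \<le> (\<Sum>n\<in>B. norm (\<theta> n x) * dirichlet_majorant N (x - y))"
      using r by (intro order_trans[OF norm_sum] sum_mono)
        (auto simp: norm_mult cube_def intro!: mult_left_mono norm_sum_chr_le_dirichlet_majorant)
    also have "\<dots> \<le> 1 * dirichlet_majorant N (x - y)"
      unfolding sum_distrib_right[symmetric] by (intro mult_right_mono le1) simp
    finally show "norm (?I x) \<le> dirichlet_majorant N (x + - y)" by simp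
  qed
  also have "\<dots> \<le> ennreal (lebesgue_bound CARD('d) N)"
    by (rule nn_integral_dirichlet_majorant)
  finally show ?thesis
    using lebesgue_bound_ge_1[of "CARD('d)" N] by (simp add: ennreal_le_iff)
qed

text \<open>The square integral is the TT* argument. By orthogonality it is a sum over pairs n, m of
  the frequencies common to two boxes, and that intersection is again a box inside the cube.
  Regrouped by m it becomes an average, with weights \<open>\<theta>' m\<close>, of functions to
  which the same kernel bound applies, so \<open>M\<close> enters only once.\<close>

lemma max_partial_sum_duality:
  fixes g :: "real ^ 'd \<Rightarrow> complex"
  assumes g [measurable]: "g \<in> borel_measurable borel" and int_g [simp]: "integrable haar g"
  obtains \<Phi> :: "real ^ 'd \<Rightarrow> complex" where "\<Phi> \<in> borel_measurable borel"
    and "\<And>y. norm (\<Phi> y) \<le> lebesgue_bound CARD('d) N"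
    and "(\<integral>\<^sup>+y. ennreal ((norm (\<Phi> y))\<^sup>2) \<partial>haar) \<le> ennreal (lebesgue_bound CARD('d) N)"
    and "(\<integral>\<^sup>+x. ennreal (max_partial_sum N g x) \<partial>haar) \<le> (\<integral>\<^sup>+y. ennreal (norm (g y) * norm (\<Phi> y)) \<partial>haar)"
proof -
  define M where "M = lebesgue_bound CARD('d) N"
  have M: "M \<ge> 1" unfolding M_def by (rule lebesgue_bound_ge_1)
  define B where "B = (cube N :: (nat ^ 'd) set)"
  have [simp]: "finite B" by (simp add: B_def)
  obtain \<theta> where \<theta> [measurable]: "\<And>n. \<theta> n \<in> borel_measurable (borel :: (real ^ 'd) measure)"
    and le1: "\<And>x. (\<Sum>n\<in>B. norm (\<theta> n x)) \<le> 1"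
    and nonneg: "\<And>x. (\<Sum>n\<in>B. \<theta> n x * rect_partial_sum n g x) = of_real (norm (\<Sum>n\<in>B. \<theta> n x * rect_partial_sum n g x))"
    and max: "\<And>x n. n \<in> B \<Longrightarrow> norm (rect_partial_sum n g x) \<le> norm (\<Sum>n\<in>B. \<theta> n x * rect_partial_sum n g x)"
    by (rule measurable_max_selector[of B "\<lambda>n. rect_partial_sum n g" borel]) auto
  \<comment> \<open>The selector is controlled only on \<open>B\<close>; extension by 0 makes every
    \<open>\<theta>' n\<close> bounded, hence integrable, as the kernel bound requires for all
    indices.\<close>
  define \<theta>' where "\<theta>' n x = (if n \<in> B then \<theta> n x else 0)" for n x
  have \<theta>'_le: "norm (\<theta>' n x) \<le> 1" for n x
    using member_le_sum[of n B "\<lambda>n. norm (\<theta> n x)"] le1[of x] by (auto simp: \<theta>'_def)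
  have \<theta>'_meas [measurable]: "\<theta>' n \<in> borel_measurable borel" for n
    unfolding \<theta>'_def by measurable
  have \<theta>'_int [simp]: "integrable haar (\<theta>' n)" for n
    by (rule haar.integrable_const_bound[where B = 1]) (auto simp: \<theta>'_le)
  have le1': "(\<Sum>n\<in>B. norm (\<theta>' n x)) \<le> 1" for x
    using le1[of x] by (simp add: \<theta>'_def)
  define c where "c n k = (LINT x|haar. \<theta>' n x * chr k x)" for n k
  have cnj_c: "cnj (c n k) = (LINT x|haar. cnj (\<theta>' n x) * cnj (chr k x))" for n k
    using Bochner_Integration.integral_cnj[of haar "\<lambda>x. \<theta>' n x * chr k x"] by (simp add: c_def)
  \<comment> \<open>The transpose of the linearized operator applied to 1: the sum over n of the
    integrals of \<open>\<theta>' n x\<close> against the Dirichlet kernel at x - y. The pairing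
    with \<open>g\<close> is bilinear, so \<open>\<theta>'\<close> carries no conjugate
    here.\<close>
  define \<Phi> where "\<Phi> y = (\<Sum>n\<in>B. \<Sum>k\<in>freq_box n. c n k * cnj (chr k y))" for y
  have \<Phi>_meas [measurable]: "\<Phi> \<in> borel_measurable borel" unfolding \<Phi>_def by measurable
  have \<Phi>_le: "norm (\<Phi> y) \<le> M" for y
    unfolding \<Phi>_def M_def c_def by (rule linearized_kernel_bound) (use le1' in \<open>auto simp: B_def\<close>)
  have \<Phi>_int [simp]: "integrable haar \<Phi>"
    by (rule haar.integrable_const_bound[where B = M]) (auto simp: \<Phi>_le)

  define s where "s x = (\<Sum>n\<in>B. \<theta>' n x * rect_partial_sum n g x)" for x
  have s_eq: "s = (\<lambda>x. \<Sum>n\<in>B. \<Sum>k\<in>freq_box n. fourier_coeff g k * (\<theta>' n x * chr k x))"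
    by (simp add: fun_eq_iff s_def rect_partial_sum_chr sum_distrib_left mult_ac)
  have s_int [simp]: "integrable haar s" unfolding s_eq by simp
  have s_nonneg: "of_real (norm (s x)) = s x" for x
    using nonneg[of x, symmetric] by (simp add: s_def \<theta>'_def)
  have g\<Phi>_eq: "(\<lambda>y. g y * \<Phi> y) = (\<lambda>y. \<Sum>n\<in>B. \<Sum>k\<in>freq_box n. c n k * (g y * cnj (chr k y)))"
    by (simp add: fun_eq_iff \<Phi>_def sum_distrib_left mult_ac)
  have g\<Phi>_int: "integrable haar (\<lambda>y. g y * \<Phi> y)" unfolding g\<Phi>_eq by simp
  have "(LINT x|haar. s x) = (\<Sum>n\<in>B. \<Sum>k\<in>freq_box n. fourier_coeff g k * c n k)"
    unfolding s_eq by (simp add: c_def)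
  also have "\<dots> = (LINT y|haar. g y * \<Phi> y)"
    unfolding g\<Phi>_eq by (simp add: fourier_coeff_haar) (simp add: mult.commute)
  finally have dual: "(LINT x|haar. s x) = (LINT y|haar. g y * \<Phi> y)" .
  have "(\<integral>\<^sup>+x. ennreal (max_partial_sum N g x) \<partial>haar) \<le> (\<integral>\<^sup>+x. ennreal (norm (s x)) \<partial>haar)"
  proof (intro nn_integral_mono ennreal_leI)
    fix x
    show "max_partial_sum N g x \<le> norm (s x)"
      unfolding max_partial_sum_def s_def
      by (subst Max_le_iff) (use max[of _ x] in \<open>auto simp: B_def \<theta>'_def\<close>)
  qed
  also have "\<dots> = ennreal (LINT x|haar. norm (s x))"
    by (rule nn_integral_eq_integral) auto
  also have "(LINT x|haar. norm (s x)) = norm (LINT y|haar. g y * \<Phi> y)"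
  proof -
    have "complex_of_real (LINT x|haar. norm (s x)) = (LINT x|haar. s x)"
      by (simp add: s_nonneg flip: integral_complex_of_real)
    hence "norm (LINT y|haar. g y * \<Phi> y) = norm (complex_of_real (LINT x|haar. norm (s x)))"
      by (simp add: dual)
    thus ?thesis by simp
  qed
  also have "ennreal \<dots> \<le> (\<integral>\<^sup>+y. ennreal (norm (g y * \<Phi> y)) \<partial>haar)"
    by (rule integral_norm_bound_ennreal[OF g\<Phi>_int])
  finally have max_le: "(\<integral>\<^sup>+x. ennreal (max_partial_sum N g x) \<partial>haar) \<le> (\<integral>\<^sup>+y. ennreal (norm (g y) * norm (\<Phi> y)) \<partial>haar)"
    by (simp add: norm_mult)

  \<comment> \<open>The kernel of the operator composed with its adjoint. Pairing
    \<open>c n k\<close> with \<open>cnj (c m k)\<close> over the common frequencies amounts to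
    integrating \<open>\<Psi> m\<close> against \<open>cnj (\<theta>' m y)\<close>.\<close>
  define \<Psi> where "\<Psi> m y = (\<Sum>n\<in>B. \<Sum>k\<in>freq_box (\<chi> j. min (n $ j) (m $ j)). c n k * cnj (chr k y))" for m y
  have box_inter: "freq_box (\<chi> j. min (n $ j) (m $ j)) = freq_box n \<inter> freq_box m" for n m :: "nat ^ 'd"
    by (auto simp: freq_box_def of_nat_min)
  have \<Psi>_le: "norm (\<Psi> m y) \<le> M" for m y
    unfolding \<Psi>_def M_def c_def
    by (rule linearized_kernel_bound) (use le1' in \<open>auto simp: B_def cube_def min.coboundedI1\<close>)
  have \<Psi>_eq: "(\<lambda>y. \<Sum>m\<in>B. cnj (\<theta>' m y) * \<Psi> m y) =
     (\<lambda>y. \<Sum>m\<in>B. \<Sum>n\<in>B. \<Sum>k\<in>freq_box n \<inter> freq_box m. c n k * (cnj (\<theta>' m y) * cnj (chr k y)))"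
    by (simp add: fun_eq_iff \<Psi>_def sum_distrib_left box_inter mult_ac)
  have \<Psi>_int: "integrable haar (\<lambda>y. \<Sum>m\<in>B. cnj (\<theta>' m y) * \<Psi> m y)"
    unfolding \<Psi>_eq by simp
  have \<Phi>\<Phi>_eq: "(\<lambda>y. \<Phi> y * cnj (\<Phi> y)) = (\<lambda>y. \<Sum>m\<in>B. \<Sum>l\<in>freq_box m. cnj (c m l) * (\<Phi> y * chr l y))"
    by (subst (2) \<Phi>_def) (simp add: fun_eq_iff sum_distrib_left mult_ac)
  have \<Phi>_coeff: "(LINT y|haar. \<Phi> y * chr l y) = (\<Sum>n\<in>B. if l \<in> freq_box n then c n l else 0)" for l
  proof -
    have "(\<lambda>y. \<Phi> y * chr l y) = (\<lambda>y. \<Sum>n\<in>B. \<Sum>k\<in>freq_box n. c n k * chr (l - k) y)"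
      by (simp add: fun_eq_iff \<Phi>_def sum_distrib_right chr_diff_left) (simp add: mult_ac)
    thus ?thesis by (simp add: integral_chr if_distrib cong: if_cong)
  qed
  have "(LINT y|haar. \<Phi> y * cnj (\<Phi> y)) =
      (\<Sum>m\<in>B. \<Sum>l\<in>freq_box m. cnj (c m l) * (\<Sum>n\<in>B. if l \<in> freq_box n then c n l else 0))"
    unfolding \<Phi>\<Phi>_eq by (simp add: \<Phi>_coeff)
  also have "\<dots> = (\<Sum>m\<in>B. \<Sum>n\<in>B. \<Sum>l\<in>freq_box m. if l \<in> freq_box n then c n l * cnj (c m l) else 0)"
    by (intro sum.cong refl, subst sum.swap) (auto simp: sum_distrib_left mult_ac intro!: sum.cong)
  also have "\<dots> = (\<Sum>m\<in>B. \<Sum>n\<in>B. \<Sum>k\<in>freq_box n \<inter> freq_box m. c n k * cnj (c m k))"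
    by (simp add: sum.inter_restrict[symmetric] Int_commute)
  also have "\<dots> = (LINT y|haar. (\<Sum>m\<in>B. cnj (\<theta>' m y) * \<Psi> m y))"
    unfolding \<Psi>_eq by (simp add: cnj_c)
  finally have norm2: "(LINT y|haar. \<Phi> y * cnj (\<Phi> y)) = (LINT y|haar. (\<Sum>m\<in>B. cnj (\<theta>' m y) * \<Psi> m y))" .
  have "(\<integral>\<^sup>+y. ennreal ((norm (\<Phi> y))\<^sup>2) \<partial>haar) = ennreal (LINT y|haar. (norm (\<Phi> y))\<^sup>2)"
    by (intro nn_integral_eq_integral haar.integrable_const_bound[where B = "M\<^sup>2"])
      (auto simp: \<Phi>_le power_mono)
  also have "(LINT y|haar. (norm (\<Phi> y))\<^sup>2) = norm (LINT y|haar. (\<Sum>m\<in>B. cnj (\<theta>' m y) * \<Psi> m y))"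
  proof -
    have "complex_of_real (LINT y|haar. (norm (\<Phi> y))\<^sup>2) = (LINT y|haar. \<Phi> y * cnj (\<Phi> y))"
      by (simp only: complex_norm_square[symmetric] integral_complex_of_real)
    hence "norm (complex_of_real (LINT y|haar. (norm (\<Phi> y))\<^sup>2)) =
        norm (LINT y|haar. (\<Sum>m\<in>B. cnj (\<theta>' m y) * \<Psi> m y))"
      by (simp only: norm2)
    thus ?thesis by simp
  qed
  also have "ennreal \<dots> \<le> (\<integral>\<^sup>+y. ennreal (norm (\<Sum>m\<in>B. cnj (\<theta>' m y) * \<Psi> m y)) \<partial>haar)"
    by (rule integral_norm_bound_ennreal[OF \<Psi>_int])
  also have "\<dots> \<le> (\<integral>\<^sup>+y. ennreal M \<partial>(haar :: (real ^ 'd) measure))"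
  proof (intro nn_integral_mono ennreal_leI)
    fix y
    have "norm (\<Sum>m\<in>B. cnj (\<theta>' m y) * \<Psi> m y) \<le> (\<Sum>m\<in>B. norm (\<theta>' m y) * M)"
      by (intro order_trans[OF norm_sum] sum_mono) (auto simp: norm_mult intro!: mult_left_mono \<Psi>_le)
    also have "\<dots> \<le> 1 * M"
      unfolding sum_distrib_right[symmetric] using M by (intro mult_right_mono le1') auto
    finally show "norm (\<Sum>m\<in>B. cnj (\<theta>' m y) * \<Psi> m y) \<le> M" by simp
  qed
  also have "\<dots> = ennreal M" by simp
  finally show ?thesis
    using that[OF \<Phi>_meas] \<Phi>_le max_le by (simp add: M_def)
qed

section \<open>An elementary substitute for interpolation and duality\<close>

text \<open>Where u > c, the bound v \<le> M suffices, since u^(1-p) decreases in u for p \<ge> 1.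
  Where u \<le> c, the product is split into (M/c) u^2 + (c/M) v^2, and u^2 \<le> c^(2-p) u^p
  because p \<le> 2. These are the two ends of the range of p.\<close>

lemma pairing_pointwise:
  fixes u v c M p :: real
  assumes "1 \<le> p" "p \<le> 2" "0 \<le> u" "0 \<le> v" "v \<le> M" "0 < M" "0 < c"
  shows "u * v \<le> M * c powr (1 - p) * u powr p + c / M * v\<^sup>2"
proof (cases "u \<le> c")
  case False
  have "u * v \<le> u * M" using assms by (intro mult_left_mono) auto
  also have "\<dots> = M * u" by simp
  also have "M * u = M * (u powr (1 - p) * u powr p)" using False assms by (simp flip: powr_add)
  also have "\<dots> \<le> M * (c powr (1 - p) * u powr p)"
    using False assms by (intro mult_left_mono mult_right_mono powr_mono2') auto
  also have "\<dots> \<le> M * c powr (1 - p) * u powr p + c / M * v\<^sup>2" using assms by simp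
  finally show ?thesis .
next
  case True
  show ?thesis
  proof (cases "u = 0")
    case False
    hence u: "u > 0" using assms by simp
    have "u\<^sup>2 = u powr (2 - p) * u powr p" using u by (simp add: powr_numeral flip: powr_add)
    also have "\<dots> \<le> c powr (2 - p) * u powr p"
      using True u assms by (intro mult_right_mono powr_mono2) auto
    also have "c powr (2 - p) = c * c powr (1 - p)"
      using assms by (simp add: powr_mult_base)
    finally have "M / c * u\<^sup>2 \<le> M / c * (c * c powr (1 - p) * u powr p)"
      using assms by (intro mult_left_mono) auto
    also have "\<dots> = M * c powr (1 - p) * u powr p" using assms by simp
    finally have *: "M / c * u\<^sup>2 \<le> M * c powr (1 - p) * u powr p" .
    \<comment> \<open>The inequality 2 x y \<le> x^2 + y^2 for x = M u and y = c v, with the factor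
      2 given away.\<close>
    have "0 \<le> (M * u - c * v)\<^sup>2 + M * u * (c * v)"
      using assms by (intro add_nonneg_nonneg mult_nonneg_nonneg) auto
    hence "M * c * (u * v) \<le> M\<^sup>2 * u\<^sup>2 + c\<^sup>2 * v\<^sup>2"
      by (simp add: power2_eq_square algebra_simps)
    hence "u * v \<le> M / c * u\<^sup>2 + c / M * v\<^sup>2"
      using assms by (simp add: field_simps power2_eq_square)
    with * show ?thesis by linarith
  qed (use assms in auto)
qed

text \<open>
  This replaces Hoelder's inequality with the interpolated bound on the dual exponent:
  a weight bounded by \<open>M\<close> whose square has integral at most \<open>M\<close> has dual norm at most \<open>M powr (1/p)\<close>.
\<close>

lemma nn_integral_pairing:
  fixes u v :: "'x \<Rightarrow> real"
  assumes p: "1 \<le> p" "p \<le> 2" and M: "0 < M" and A: "0 < A"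
    and [measurable]: "u \<in> borel_measurable N" "v \<in> borel_measurable N"
    and u: "\<And>x. 0 \<le> u x" "(\<integral>\<^sup>+x. ennreal (u x powr p) \<partial>N) \<le> ennreal (A powr p)"
    and v: "\<And>x. 0 \<le> v x" "\<And>x. v x \<le> M" "(\<integral>\<^sup>+x. ennreal ((v x)\<^sup>2) \<partial>N) \<le> ennreal M"
  shows "(\<integral>\<^sup>+x. ennreal (u x * v x) \<partial>N) \<le> ennreal (2 * M powr (1 / p) * A)"
proof -
  \<comment> \<open>The threshold that balances the two terms: M c^(1-p) A^p = c.\<close>
  define c where "c = M powr (1 / p) * A"
  have c: "c > 0" using M A by (simp add: c_def)
  have "(\<integral>\<^sup>+x. ennreal (u x * v x) \<partial>N) \<le>
     (\<integral>\<^sup>+x. ennreal (M * c powr (1 - p)) * ennreal (u x powr p) + ennreal (c / M) * ennreal ((v x)\<^sup>2) \<partial>N)"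
    using pairing_pointwise[OF p u(1) v(1) v(2) M c] M c
    by (intro nn_integral_mono) (simp flip: ennreal_mult ennreal_plus add: ennreal_leI)
  also have "\<dots> = ennreal (M * c powr (1 - p)) * (\<integral>\<^sup>+x. ennreal (u x powr p) \<partial>N) +
                ennreal (c / M) * (\<integral>\<^sup>+x. ennreal ((v x)\<^sup>2) \<partial>N)"
    by (simp add: nn_integral_add nn_integral_cmult)
  also have "\<dots> \<le> ennreal (M * c powr (1 - p)) * ennreal (A powr p) + ennreal (c / M) * ennreal M"
    by (intro add_mono mult_left_mono u v) auto
  also have "\<dots> = ennreal (M * c powr (1 - p) * A powr p + c)"
    using M c by (simp flip: ennreal_mult ennreal_plus)
  also have "M * c powr (1 - p) * A powr p = c"
  proof -
    have "M * c powr (1 - p) * A powr p = (M powr (1 / p * (1 - p)) * M powr 1) * (A powr (1 - p) * A powr p)"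
      using M A by (simp add: c_def powr_mult powr_powr)
    also have "\<dots> = M powr (1 / p * (1 - p) + 1) * A powr ((1 - p) + p)"
      by (simp only: powr_add)
    also have "1 / p * (1 - p) + 1 = 1 / p" using p by (simp add: field_simps)
    finally show ?thesis using A by (simp add: c_def)
  qed
  also have "c + c = 2 * M powr (1 / p) * A" by (simp add: c_def)
  finally show ?thesis .
qed

section \<open>Fejer means\<close>

text \<open>
  The factors outside \<open>J\<close> are omitted so that the tail in one coordinate can be estimated with the
  kernel in the remaining ones.
\<close>

definition fejer_on :: "'d::finite set \<Rightarrow> nat \<Rightarrow> real ^ 'd \<Rightarrow> real" where
  "fejer_on J K x = (\<Prod>j\<in>J. (norm (exp_sum_over {0..<int K} (x $ j)))\<^sup>2 / real K)"

text \<open>Coordinates outside \<open>J\<close> are held at frequency 0, where the exponential sum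
  equals 1, so that the product over all coordinates reduces to one over \<open>J\<close>.\<close>

definition fejer_set :: "'d::finite set \<Rightarrow> nat \<Rightarrow> (int ^ 'd) set" where
  "fejer_set J K = {k. \<forall>j. k $ j \<in> (if j \<in> J then {0..<int K} else {0})}"

lemma fejer_on_nonneg [simp]: "0 \<le> fejer_on J K x"
  unfolding fejer_on_def by (intro prod_nonneg) simp

lemma fejer_on_measurable [measurable]: "fejer_on J K \<in> borel_measurable borel"
  unfolding fejer_on_def by measurable

lemma sum_chr_fejer_set:
  "(\<Sum>k\<in>fejer_set J K. chr k x) = (\<Prod>j\<in>J. exp_sum_over {0..<int K} (x $ j))"
proof -
  have "(\<Sum>k\<in>fejer_set J K. chr k x) =
        (\<Prod>j\<in>UNIV. exp_sum_over (if j \<in> J then {0..<int K} else {0}) (x $ j))"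
    unfolding fejer_set_def by (rule sum_chr_box) simp
  also have "\<dots> = (\<Prod>j\<in>J. exp_sum_over (if j \<in> J then {0..<int K} else {0}) (x $ j))"
    by (rule prod.mono_neutral_right) (auto simp: exp_sum_over_def)
  finally show ?thesis by simp
qed

text \<open>At the origin every character equals 1, so the product formula counts the set.\<close>

lemma card_fejer_set: "card (fejer_set J K) = K ^ card J"
proof -
  have "of_nat (card (fejer_set J K)) = (\<Sum>k\<in>fejer_set J K. chr k 0)"
    by (simp add: chr_def freq_dot_def)
  also have "\<dots> = of_nat (K ^ card J)"
    unfolding sum_chr_fejer_set by (simp add: exp_sum_over_def)
  finally show ?thesis using of_nat_eq_iff by blast
qed

lemma fejer_on_eq:
  "complex_of_real (fejer_on J K x) =
     (\<Sum>k\<in>fejer_set J K. \<Sum>l\<in>fejer_set J K. chr (k - l) x / of_nat (K ^ card J))"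
proof -
  have "fejer_on J K x = (norm (\<Sum>k\<in>fejer_set J K. chr k x))\<^sup>2 / real (K ^ card J)"
    unfolding fejer_on_def sum_chr_fejer_set
    by (simp add: prod_dividef prod_power_distrib flip: prod_norm)
  hence "complex_of_real (fejer_on J K x) =
      complex_of_real ((norm (\<Sum>k\<in>fejer_set J K. chr k x))\<^sup>2) / of_nat (K ^ card J)"
    by simp
  also have "\<dots> = (\<Sum>k\<in>fejer_set J K. chr k x) * cnj (\<Sum>l\<in>fejer_set J K. chr l x) / of_nat (K ^ card J)"
    by (simp only: complex_norm_square)
  finally have "complex_of_real (fejer_on J K x) =
      (\<Sum>k\<in>fejer_set J K. chr k x) * cnj (\<Sum>l\<in>fejer_set J K. chr l x) / of_nat (K ^ card J)" .
  thus ?thesis by (simp add: chr_diff_left sum_product sum_divide_distrib)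
qed

text \<open>Only the diagonal of the double sum survives integration, and its
  \<open>K ^ card J\<close> terms cancel the normalization.\<close>

lemma integral_fejer_on:
  assumes "K \<ge> 1"
  shows "(\<integral>\<^sup>+x. ennreal (fejer_on J K x) \<partial>haar) = 1"
    and "integrable haar (fejer_on J K)" and "(LINT x|haar. fejer_on J K x) = 1"
proof -
  have eq: "(\<lambda>x. complex_of_real (fejer_on J K x)) =
      (\<lambda>x. \<Sum>k\<in>fejer_set J K. \<Sum>l\<in>fejer_set J K. chr (k - l) x / of_nat (K ^ card J))"
    by (simp add: fun_eq_iff fejer_on_eq)
  have "integrable haar (\<lambda>x. complex_of_real (fejer_on J K x))"
    unfolding eq by simp
  thus int: "integrable haar (fejer_on J K)" by (simp add: complex_of_real_integrable_eq)
  have fin: "finite (fejer_set J K)" using card_fejer_set[of J K] assms by (intro card_ge_0_finite) simp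
  have "(LINT x|haar. complex_of_real (fejer_on J K x)) =
        (\<Sum>k\<in>fejer_set J K. \<Sum>l\<in>fejer_set J K. (if k = l then 1 else 0) / of_nat (K ^ card J))"
    unfolding eq by (simp add: integral_chr)
  also have "\<dots> = 1"
    using fin assms by (simp add: if_distrib[where f = "\<lambda>z. z / _"] card_fejer_set cong: if_cong)
  finally show one: "(LINT x|haar. fejer_on J K x) = 1"
    by (simp add: integral_complex_of_real)
  show "(\<integral>\<^sup>+x. ennreal (fejer_on J K x) \<partial>haar) = 1"
    using int by (subst nn_integral_eq_integral) (auto simp: one)
qed

text \<open>The convolution with the Fejer kernel written out in frequencies, which shows it to be a
  trigonometric polynomial. The differences appear as \<open>l - k\<close>, opposite to the kernel,
  because integrating \<open>f (x + t)\<close> against a character in \<open>t\<close> reverses its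
  frequency.\<close>

definition fejer_mean :: "nat \<Rightarrow> (real ^ 'd \<Rightarrow> complex) \<Rightarrow> real ^ 'd \<Rightarrow> complex" where
  "fejer_mean K f x = (\<Sum>k\<in>fejer_set UNIV K. \<Sum>l\<in>fejer_set UNIV K.
     fourier_coeff f (l - k) / of_nat (K ^ CARD('d)) * chr (l - k) x)"

lemma trig_poly_fejer_mean: "trig_poly K (fejer_mean K f)"
proof -
  have "l - k \<in> freq_box (\<chi> j. K)" if "k \<in> fejer_set UNIV K" "l \<in> fejer_set UNIV K" for k l :: "int ^ 'a"
    unfolding freq_box_def
  proof safe
    fix j
    have "k $ j \<in> {0..<int K}" "l $ j \<in> {0..<int K}" using that by (auto simp: fejer_set_def)
    thus "\<bar>(l - k) $ j\<bar> \<le> int ((\<chi> j. K) $ j)" by (simp; linarith)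
  qed
  thus ?thesis
    unfolding fejer_mean_def by (intro trig_poly_sum trig_poly_cmult trig_poly_chr) auto
qed

lemma fejer_mean_integral:
  fixes f :: "real ^ 'd \<Rightarrow> complex"
  assumes f: "torus_periodic f" and [measurable]: "f \<in> borel_measurable borel" and int_f: "integrable haar f"
  shows "(LINT t|haar. f (x + t) * complex_of_real (fejer_on UNIV K t)) = fejer_mean K f x"
    and "integrable haar (\<lambda>t. f (x + t) * complex_of_real (fejer_on UNIV K t))"
proof -
  have shift_int [simp]: "integrable haar (\<lambda>t. f (x + t))"
    using integrable_haar_shift[OF f, of x] int_f by (simp add: add.commute)
  have coeff: "(LINT t|haar. f (x + t) * chr m t) = fourier_coeff f (- m) * chr (- m) x" for m
  proof -
    have "torus_periodic (\<lambda>y. f y * chr m y)"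
      using f torus_periodic_chr[of m] by (simp add: torus_periodic_def)
    hence "(LINT t|haar. f (t + x) * chr m (t + x)) = (LINT y|haar. f y * chr m y)"
      by (rule integral_haar_shift) measurable
    hence "(LINT t|haar. f (x + t) * chr m t) * chr m x = fourier_coeff f (- m)"
      by (simp add: fourier_coeff_haar chr_uminus_left chr_add_right add.commute mult.assoc[symmetric])
    hence "(LINT t|haar. f (x + t) * chr m t) * (chr m x * cnj (chr m x)) = fourier_coeff f (- m) * cnj (chr m x)"
      by (simp only: mult.assoc[symmetric])
    thus ?thesis by (simp add: chr_uminus_left)
  qed
  have eq: "(\<lambda>t. f (x + t) * complex_of_real (fejer_on UNIV K t)) =
    (\<lambda>t. \<Sum>k\<in>fejer_set UNIV K. \<Sum>l\<in>fejer_set UNIV K. (f (x + t) * chr (k - l) t) / of_nat (K ^ CARD('d)))"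
    by (simp add: fun_eq_iff fejer_on_eq sum_distrib_left)
  show "integrable haar (\<lambda>t. f (x + t) * complex_of_real (fejer_on UNIV K t))"
    unfolding eq by simp
  show "(LINT t|haar. f (x + t) * complex_of_real (fejer_on UNIV K t)) = fejer_mean K f x"
    unfolding eq fejer_mean_def by (simp add: coeff)
qed

text \<open>The kernel has integral 1, so \<open>f x\<close> can be moved under the
  integral.\<close>

lemma norm_sub_fejer_mean_le:
  fixes f :: "real ^ 'd \<Rightarrow> complex"
  assumes f: "torus_periodic f" "f \<in> borel_measurable borel" "integrable haar f" and K: "K \<ge> 1"
  shows "ennreal (norm (f x - fejer_mean K f x)) \<le>
           (\<integral>\<^sup>+t. ennreal (norm (f (x + t) - f x) * fejer_on UNIV K t) \<partial>haar)"
proof -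
  note fm = fejer_mean_integral[OF f, of x K] and F = integral_fejer_on[OF K, of "UNIV :: 'd set"]
  have intF: "integrable haar (\<lambda>t :: real ^ 'd. f x * complex_of_real (fejer_on UNIV K t))"
    using F(2) by (intro integrable_mult_right) (simp add: complex_of_real_integrable_eq)
  have int: "integrable haar (\<lambda>t. (f (x + t) - f x) * complex_of_real (fejer_on UNIV K t))"
    using fm(2) intF by (simp add: left_diff_distrib)
  have "(LINT t|(haar :: (real ^ 'd) measure). f x * complex_of_real (fejer_on UNIV K t)) = f x"
    using F by (simp add: integral_complex_of_real)
  hence "(LINT t|haar. (f (x + t) - f x) * complex_of_real (fejer_on UNIV K t)) = fejer_mean K f x - f x"
    using fm intF by (simp add: left_diff_distrib)
  hence "ennreal (norm (f x - fejer_mean K f x)) =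
      ennreal (norm (LINT t|haar. (f (x + t) - f x) * complex_of_real (fejer_on UNIV K t)))"
    by (simp add: norm_minus_commute)
  also have "\<dots> \<le> (\<integral>\<^sup>+t. ennreal (norm ((f (x + t) - f x) * complex_of_real (fejer_on UNIV K t))) \<partial>haar)"
    by (rule integral_norm_bound_ennreal[OF int])
  finally show ?thesis by (simp add: norm_mult)
qed

lemma AE_haar_cell: "AE x in haar. x \<in> cell"
  unfolding haar_def by (subst AE_density) (auto simp: indicator_def)

text \<open>Some coordinate is farther than \<delta> from the lattice, and its factor alone is at
  most pi^2 / (K \<delta>^2). Which coordinate it is depends on \<open>t\<close>; the sum over all
  \<open>j\<close> covers every case, and each summand still has integral 1.\<close>

lemma fejer_on_tail:
  fixes t :: "real ^ 'd"
  assumes K: "K \<ge> 1" and \<delta>: "0 < \<delta>" and t: "t \<in> cell" "\<delta> < torus_abs t"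
  shows "fejer_on UNIV K t \<le> pi\<^sup>2 / (real K * \<delta>\<^sup>2) * (\<Sum>j\<in>UNIV. fejer_on (UNIV - {j}) K t)"
proof -
  have "torus_abs t \<in> range (\<lambda>j. circle_abs (t $ j))"
    unfolding torus_abs_def by (rule Max_in) auto
  then obtain j where j: "\<delta> < circle_abs (t $ j)" using t by auto
  have le: "circle_abs s \<le> \<bar>s - 2 * pi * of_int k\<bar>" for s k
    unfolding circle_abs_def using infdist_le[of "2 * pi * of_int k" "range (\<lambda>k. 2 * pi * of_int k)" s]
    by (simp add: dist_real_def)
  have tj: "0 \<le> t $ j" "t $ j < 2 * pi" using t by (auto simp: cell_def)
  have min: "\<delta> < min (t $ j) (2 * pi - t $ j)"
    using le[of "t $ j" 0] le[of "t $ j" 1] j tj by simp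
  let ?q = "norm (exp_sum_over {0..<int K} (t $ j))"
  have "?q * \<delta> \<le> ?q * min (t $ j) (2 * pi - t $ j)" using min by (intro mult_left_mono) auto
  also have "\<dots> \<le> pi" by (rule norm_exp_sum_over_min) (use tj in auto)
  finally have "(?q * \<delta>)\<^sup>2 \<le> pi\<^sup>2" using \<delta> by (intro power_mono) auto
  hence q: "?q\<^sup>2 / real K \<le> pi\<^sup>2 / (real K * \<delta>\<^sup>2)"
    using \<delta> K by (simp add: field_simps power_mult_distrib)
  have "fejer_on UNIV K t = ?q\<^sup>2 / real K * fejer_on (UNIV - {j}) K t"
    unfolding fejer_on_def by (rule prod.remove) auto
  also have "\<dots> \<le> pi\<^sup>2 / (real K * \<delta>\<^sup>2) * fejer_on (UNIV - {j}) K t"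
    by (rule mult_right_mono[OF q]) simp
  also have "\<dots> \<le> pi\<^sup>2 / (real K * \<delta>\<^sup>2) * (\<Sum>j\<in>UNIV. fejer_on (UNIV - {j}) K t)"
    by (intro mult_left_mono member_le_sum) auto
  finally show ?thesis .
qed

text \<open>Fubini moves the weight inside the average over translations \<open>t\<close>, so the
  pairing estimate applies for each \<open>t\<close> separately. Small \<open>t\<close> are governed
  by \<open>W\<close>; for the others the triangle inequality and translation invariance give twice
  the bound for \<open>B\<close>, multiplied by the mass of the kernel's tail.\<close>

lemma nn_integral_fejer_mean_approx:
  fixes f :: "real ^ 'd \<Rightarrow> complex" and v :: "real ^ 'd \<Rightarrow> real"
  assumes p: "1 \<le> p" "p \<le> 2" and M: "0 < M" and W: "0 < W" and B: "0 < B"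
    and K: "K \<ge> 1" and \<delta>: "0 < \<delta>"
    and f: "torus_periodic f" "f \<in> borel_measurable borel" "integrable haar f"
    and fB: "(\<integral>\<^sup>+x. ennreal (norm (f x) powr p) \<partial>haar) \<le> ennreal (B powr p)"
    and fW: "\<And>h. torus_abs h \<le> \<delta> \<Longrightarrow> (\<integral>\<^sup>+x. ennreal (norm (f (x + h) - f x) powr p) \<partial>haar) \<le> ennreal (W powr p)"
    and v [measurable]: "v \<in> borel_measurable borel"
    and v_bounds: "\<And>x. 0 \<le> v x" "\<And>x. v x \<le> M" "(\<integral>\<^sup>+x. ennreal ((v x)\<^sup>2) \<partial>haar) \<le> ennreal M"
  shows "(\<integral>\<^sup>+x. ennreal (norm (f x - fejer_mean K f x) * v x) \<partial>haar) \<le>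
     ennreal (2 * M powr (1 / p) * (W + 2 * B * (real CARD('d) * (pi\<^sup>2 / (real K * \<delta>\<^sup>2)))))"
proof -
  note [measurable] = f(2)
  note pairing = nn_integral_pairing[OF p M, where N = haar and v = v, OF _ _ _ _ _ v_bounds]
  define C where "C = 2 * M powr (1 / p)"
  define \<epsilon> where "\<epsilon> = pi\<^sup>2 / (real K * \<delta>\<^sup>2)"
  have C: "C \<ge> 0" and \<epsilon>: "\<epsilon> \<ge> 0" using M \<delta> by (auto simp: C_def \<epsilon>_def)
  define I where "I t = (\<integral>\<^sup>+x. ennreal (norm (f (x + t) - f x) * v x) \<partial>haar)" for t
  have near: "I t \<le> ennreal (C * W)" if "torus_abs t \<le> \<delta>" for t
    unfolding I_def C_def by (intro pairing W fW that) auto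
  have far: "I t \<le> ennreal (2 * (C * B))" for t
  proof -
    have "(\<integral>\<^sup>+x. ennreal (norm (f (x + t)) powr p) \<partial>haar) = (\<integral>\<^sup>+x. ennreal (norm (f x) powr p) \<partial>haar)"
      using f(1) by (intro nn_integral_haar_shift[where F = "\<lambda>x. ennreal (norm (f x) powr p)"])
        (auto simp: torus_periodic_def)
    hence fB': "(\<integral>\<^sup>+x. ennreal (norm (f (x + t)) powr p) \<partial>haar) \<le> ennreal (B powr p)"
      using fB by simp
    have "I t \<le> (\<integral>\<^sup>+x. ennreal (norm (f (x + t)) * v x) + ennreal (norm (f x) * v x) \<partial>haar)"
      unfolding I_def using v_bounds(1)
      by (intro nn_integral_mono)
        (auto simp flip: ennreal_plus distrib_right intro!: ennreal_leI mult_right_mono norm_triangle_ineq4)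
    also have "\<dots> = (\<integral>\<^sup>+x. ennreal (norm (f (x + t)) * v x) \<partial>haar) + (\<integral>\<^sup>+x. ennreal (norm (f x) * v x) \<partial>haar)"
      by (rule nn_integral_add) auto
    also have "\<dots> \<le> ennreal (C * B) + ennreal (C * B)"
      unfolding C_def by (intro add_mono pairing B fB fB') auto
    also have "\<dots> = ennreal (2 * (C * B))" using C B by (simp flip: ennreal_plus)
    finally show ?thesis .
  qed
  have "(\<integral>\<^sup>+x. ennreal (norm (f x - fejer_mean K f x) * v x) \<partial>haar) \<le>
     (\<integral>\<^sup>+x. \<integral>\<^sup>+t. ennreal (fejer_on UNIV K t) * ennreal (norm (f (x + t) - f x) * v x) \<partial>haar \<partial>haar)"
  proof (intro nn_integral_mono)
    fix x
    have "ennreal (norm (f x - fejer_mean K f x) * v x) \<le>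
        (\<integral>\<^sup>+t. ennreal (norm (f (x + t) - f x) * fejer_on UNIV K t) \<partial>haar) * ennreal (v x)"
      using norm_sub_fejer_mean_le[OF f K, of x] v_bounds(1)
      by (simp add: ennreal_mult mult_right_mono)
    also have "\<dots> = (\<integral>\<^sup>+t. ennreal (fejer_on UNIV K t) * ennreal (norm (f (x + t) - f x) * v x) \<partial>haar)"
      using v_bounds(1) by (subst nn_integral_multc[symmetric])
        (auto simp: mult_ac simp flip: ennreal_mult intro!: nn_integral_cong)
    finally show "ennreal (norm (f x - fejer_mean K f x) * v x) \<le> \<dots>" .
  qed
  also have "\<dots> = (\<integral>\<^sup>+t. \<integral>\<^sup>+x. ennreal (fejer_on UNIV K t) * ennreal (norm (f (x + t) - f x) * v x) \<partial>haar \<partial>haar)"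
    by (rule haar_pair.Fubini'[symmetric]) measurable
  also have "\<dots> = (\<integral>\<^sup>+t. ennreal (fejer_on UNIV K t) * I t \<partial>haar)"
    unfolding I_def by (intro nn_integral_cong nn_integral_cmult) measurable
  also have "\<dots> \<le> (\<integral>\<^sup>+t. ennreal (C * W) * ennreal (fejer_on UNIV K t) +
      ennreal (2 * (C * B) * \<epsilon>) * (\<Sum>j\<in>UNIV. ennreal (fejer_on (UNIV - {j}) K t)) \<partial>(haar :: (real ^ 'd) measure))"
  \<comment> \<open>The tail bound for the kernel holds on the cell, which carries the whole
    measure.\<close>
  proof (rule nn_integral_mono_AE)
    show "AE t in haar. ennreal (fejer_on UNIV K t) * I t \<le> ennreal (C * W) * ennreal (fejer_on UNIV K t) +
      ennreal (2 * (C * B) * \<epsilon>) * (\<Sum>j\<in>UNIV. ennreal (fejer_on (UNIV - {j}) K t))"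
      using AE_haar_cell
    proof eventually_elim
      case (elim t)
      show ?case
      proof (cases "torus_abs t \<le> \<delta>")
        case True
        have "ennreal (fejer_on UNIV K t) * I t \<le> ennreal (C * W) * ennreal (fejer_on UNIV K t)"
          using near[OF True] by (subst mult.commute) (rule mult_right_mono, auto)
        thus ?thesis by (rule order_trans) simp
      next
        case False
        have "ennreal (fejer_on UNIV K t) * I t \<le> ennreal (\<epsilon> * (\<Sum>j\<in>UNIV. fejer_on (UNIV - {j}) K t)) * ennreal (2 * (C * B))"
          using fejer_on_tail[OF K \<delta> elim, folded \<epsilon>_def] False far[of t] by (intro mult_mono ennreal_leI) auto
        also have "\<dots> = ennreal (2 * (C * B) * \<epsilon>) * (\<Sum>j\<in>UNIV. ennreal (fejer_on (UNIV - {j}) K t))"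
          using C B \<epsilon> by (simp add: mult_ac sum_nonneg flip: ennreal_mult)
        finally show ?thesis by (rule order_trans) simp
      qed
    qed
  qed
  also have "\<dots> = ennreal (C * W) + ennreal (2 * (C * B) * \<epsilon>) * of_nat CARD('d)"
    by (simp add: nn_integral_add nn_integral_cmult nn_integral_sum integral_fejer_on[OF K] del: sum_ennreal)
  also have "\<dots> = ennreal (C * W + 2 * (C * B) * \<epsilon> * real CARD('d))"
    using C W B \<epsilon> by (simp add: ennreal_of_nat_eq_real_of_nat flip: ennreal_mult ennreal_plus)
  also have "C * W + 2 * (C * B) * \<epsilon> * real CARD('d) = C * (W + 2 * B * (real CARD('d) * \<epsilon>))"
    by (simp add: algebra_simps)
  finally show ?thesis by (simp only: C_def \<epsilon>_def)
qed

section \<open>Almost everywhere convergence\<close>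

lemma eventually_pringsheimI:
  assumes "\<And>n. (\<And>j. K \<le> n $ j) \<Longrightarrow> P n"
  shows "eventually P pringsheim"
  unfolding pringsheim_def eventually_filtercomap
proof (intro exI[of _ "\<lambda>m. K \<le> m"] conjI allI impI)
  fix n :: "nat ^ 'a" assume "K \<le> (MIN j. n $ j)"
  hence "K \<le> n $ j" for j by (subst (asm) Min_ge_iff) auto
  thus "P n" by (rule assms)
qed (rule eventually_ge_at_top)

lemma norm_rect_partial_sum_trig_poly_le:
  assumes "trig_poly K P"
  shows "norm (rect_partial_sum n P x) \<le> max_partial_sum K P x"
  by (subst rect_partial_sum_trig_poly_min[OF assms]) (rule max_partial_sum_ge, simp add: cube_def)

text \<open>Once all sides of n are at least \<open>K J\<close>, the partial sum reproduces
  \<open>P J\<close> exactly, and all later blocks together contribute at most a tail of the series,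
  uniformly in n. For fixed n only finitely many coefficients occur, so coefficientwise convergence
  is enough to pass from \<open>P j\<close> to \<open>f\<close>.\<close>

lemma pringsheim_limit_if_summable_maxima:
  fixes f :: "real ^ 'd \<Rightarrow> complex" and P :: "nat \<Rightarrow> real ^ 'd \<Rightarrow> complex"
  assumes P: "\<And>j. trig_poly (K j) (P j)" and K: "incseq K"
    and sum: "summable (\<lambda>j. max_partial_sum (K (Suc j)) (\<lambda>x. P (Suc j) x - P j x) x)"
    and lim: "(\<lambda>j. P j x) \<longlonglongrightarrow> f x"
    and coeff: "\<And>k. (\<lambda>j. fourier_coeff (P j) k) \<longlonglongrightarrow> fourier_coeff f k"
  shows "((\<lambda>n. rect_partial_sum n f x) \<longlongrightarrow> f x) pringsheim"
proof (rule tendstoI)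
  fix e :: real assume e: "e > 0"
  define g where "g j = max_partial_sum (K (Suc j)) (\<lambda>x. P (Suc j) x - P j x) x" for j
  have g: "summable g" "\<And>j. 0 \<le> g j" using sum by (simp_all add: g_def[abs_def])
  have "(\<lambda>J. \<Sum>j. g (j + J)) \<longlonglongrightarrow> 0" by (rule suminf_exist_split2[OF g(1)])
  from tendstoD[OF this, of "e / 2"]
  have "eventually (\<lambda>J. norm (\<Sum>j. g (j + J)) < e / 2) sequentially"
    using e by (simp add: dist_norm)
  moreover have "eventually (\<lambda>J. dist (P J x) (f x) < e / 2) sequentially"
    using e by (intro tendstoD[OF lim]) auto
  ultimately have "eventually (\<lambda>J. norm (\<Sum>j. g (j + J)) < e / 2 \<and> dist (P J x) (f x) < e / 2) sequentially"
    by (rule eventually_conj)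
  then obtain J where J: "norm (\<Sum>j. g (j + J)) < e / 2" "dist (P J x) (f x) < e / 2"
    by (auto simp: eventually_sequentially)
  show "eventually (\<lambda>n. dist (rect_partial_sum n f x) (f x) < e) pringsheim"
  proof (rule eventually_pringsheimI[of "K J"])
    fix n :: "nat ^ 'd" assume n: "\<And>j. K J \<le> n $ j"
    define T where "T j = rect_partial_sum n (P j) x" for j
    have T_step: "norm (T (Suc j) - T j) \<le> g j" for j
    proof -
      have "T (Suc j) - T j = rect_partial_sum n (\<lambda>x. P (Suc j) x - P j x) x"
        unfolding T_def using P by (subst rect_partial_sum_diff) (auto intro: trig_poly_measurable trig_poly_integrable)
      thus ?thesis unfolding g_def
        using trig_poly_diff[OF P[of "Suc j"] trig_poly_mono[OF P[of j], of "K (Suc j)"]] K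
        by (simp add: incseq_SucD norm_rect_partial_sum_trig_poly_le)
    qed
    have partial: "norm (T (J + m) - T J) \<le> (\<Sum>j<m. g (j + J))" for m
    proof (induction m)
      case (Suc m)
      have "norm (T (J + Suc m) - T J) \<le> norm (T (Suc (J + m)) - T (J + m)) + norm (T (J + m) - T J)"
        using norm_triangle_ineq[of "T (Suc (J + m)) - T (J + m)" "T (J + m) - T J"] by simp
      thus ?case using Suc T_step[of "J + m"] by (simp add: add.commute)
    qed simp
    have bound: "norm (T (m + J) - T J) \<le> (\<Sum>j. g (j + J))" for m
    proof -
      have "(\<Sum>j<m. g (j + J)) \<le> (\<Sum>j. g (j + J))"
        using g by (intro sum_le_suminf summable_ignore_initial_segment) auto
      thus ?thesis using partial[of m] by (simp add: add.commute)
    qed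
    have "T \<longlonglongrightarrow> rect_partial_sum n f x"
      unfolding T_def rect_partial_sum_chr by (intro tendsto_intros coeff)
    hence "(\<lambda>m. T (m + J) - T J) \<longlonglongrightarrow> rect_partial_sum n f x - T J"
      by (intro tendsto_diff tendsto_const LIMSEQ_ignore_initial_segment)
    hence "norm (rect_partial_sum n f x - T J) \<le> (\<Sum>j. g (j + J))"
      by (rule Lim_norm_ubound[rotated]) (auto simp: bound)
    moreover have "T J = P J x"
      unfolding T_def by (rule rect_partial_sum_trig_poly[OF P n])
    ultimately have "dist (rect_partial_sum n f x) (P J x) < e / 2"
      using J(1) by (simp add: dist_norm)
    thus "dist (rect_partial_sum n f x) (f x) < e"
      using J(2) dist_triangle[of "rect_partial_sum n f x" "f x" "P J x"] by linarith
  qed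
qed

text \<open>\<open>R j\<close> bounds the Fejer error at stage \<open>j\<close> before the factor
  from the kernel. The block between consecutive means is compared with \<open>f\<close> on both
  sides, which explains the sum \<open>R j + R (Suc j)\<close>.\<close>

lemma AE_pringsheim_if_summable_rates:
  fixes f :: "real ^ 'd \<Rightarrow> complex" and K :: "nat \<Rightarrow> nat" and W \<delta> :: "nat \<Rightarrow> real"
  assumes p: "1 \<le> p" "p \<le> 2" and B: "0 < B" and W: "\<And>j. 0 < W j"
    and K: "\<And>j. K j \<ge> 1" "incseq K" and \<delta>: "\<And>j. 0 < \<delta> j"
    and f: "torus_periodic f" "f \<in> borel_measurable borel" "integrable haar f"
    and fB: "(\<integral>\<^sup>+x. ennreal (norm (f x) powr p) \<partial>haar) \<le> ennreal (B powr p)"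
    and fW: "\<And>j h. torus_abs h \<le> \<delta> j \<Longrightarrow>
      (\<integral>\<^sup>+x. ennreal (norm (f (x + h) - f x) powr p) \<partial>haar) \<le> ennreal (W j powr p)"
    and R: "\<And>j. R j = W j + 2 * B * (real CARD('d) * (pi\<^sup>2 / (real (K j) * (\<delta> j)\<^sup>2)))"
    and summable: "summable (\<lambda>j. lebesgue_bound CARD('d) (K (Suc j)) powr (1 / p) * (R j + R (Suc j)))"
  shows "AE x in haar. ((\<lambda>n. rect_partial_sum n f x) \<longlongrightarrow> f x) pringsheim"
proof -
  note [measurable] = f(2)
  \<comment> \<open>The block \<open>D j\<close> has degree \<open>K (Suc j)\<close>, so its maximal
    function calls for the bound of that degree even when the error at stage \<open>j\<close> is
    estimated.\<close>
  define M where "M j = lebesgue_bound CARD('d) (K (Suc j))" for j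
  have M: "M j \<ge> 1" for j unfolding M_def by (rule lebesgue_bound_ge_1)
  have R_nonneg: "0 \<le> R j" for j unfolding R using W[of j] B \<delta>[of j] by simp
  define P where "P j = fejer_mean (K j) f" for j
  have P: "trig_poly (K j) (P j)" for j unfolding P_def by (rule trig_poly_fejer_mean)
  note P_meas [measurable] = trig_poly_measurable[OF P] and P_int = trig_poly_integrable[OF P]
  define D where "D j x = P (Suc j) x - P j x" for j x
  have D_meas [measurable]: "D j \<in> borel_measurable borel" for j unfolding D_def by measurable
  have D_int: "integrable haar (D j)" for j unfolding D_def using P_int by simp
  define a where "a j = 2 * (M j powr (1 / p) * (R j + R (Suc j)))" for j
  have a: "summable a" "\<And>j. 0 \<le> a j"
    using summable_mult[OF summable, of 2] R_nonneg by (simp_all add: a_def[abs_def] M_def)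
  have approx: "(\<integral>\<^sup>+x. ennreal (norm (f x - P i x) * v x) \<partial>haar) \<le> ennreal (2 * M j powr (1 / p) * R i)"
    if v: "v \<in> borel_measurable borel" "\<And>x. 0 \<le> v x" "\<And>x. v x \<le> M j"
      "(\<integral>\<^sup>+x. ennreal ((v x)\<^sup>2) \<partial>haar) \<le> ennreal (M j)" for i j and v :: "real ^ 'd \<Rightarrow> real"
    unfolding P_def R
    by (rule nn_integral_fejer_mean_approx[OF p _ W B K(1) \<delta> f fB fW v]) (use M[of j] in auto)
  have P_approx: "(\<integral>\<^sup>+x. ennreal (norm (f x - P j x)) \<partial>haar) \<le> ennreal (a j)" for j
  proof -
    have "(\<integral>\<^sup>+x. ennreal (norm (f x - P j x)) \<partial>haar) \<le> ennreal (2 * M j powr (1 / p) * R j)"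
      \<comment> \<open>The weight 1 is admissible since \<open>M j\<close> is at least 1; it yields
        the plain L^1 error.\<close>
      using approx[of "\<lambda>_. 1" j j] M[of j] ennreal_leI[OF M[of j]] by simp
    also have "\<dots> \<le> ennreal (a j)"
      using R_nonneg[of "Suc j"] by (intro ennreal_leI) (simp add: a_def algebra_simps)
    finally show ?thesis .
  qed
  have max_bound: "(\<integral>\<^sup>+x. ennreal (max_partial_sum (K (Suc j)) (D j) x) \<partial>haar) \<le> ennreal (a j)" for j
  proof -
    obtain \<Phi> :: "real ^ 'd \<Rightarrow> complex" where \<Phi>: "\<Phi> \<in> borel_measurable borel" "\<And>y. norm (\<Phi> y) \<le> M j"
      "(\<integral>\<^sup>+y. ennreal ((norm (\<Phi> y))\<^sup>2) \<partial>haar) \<le> ennreal (M j)"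
      "(\<integral>\<^sup>+x. ennreal (max_partial_sum (K (Suc j)) (D j) x) \<partial>haar) \<le>
         (\<integral>\<^sup>+y. ennreal (norm (D j y) * norm (\<Phi> y)) \<partial>haar)"
      by (rule max_partial_sum_duality[OF D_meas[of j] D_int[of j], of "K (Suc j)", folded M_def]) (rule that)
    note [measurable] = \<Phi>(1)
    have approx\<Phi>: "(\<integral>\<^sup>+x. ennreal (norm (f x - P i x) * norm (\<Phi> x)) \<partial>haar) \<le> ennreal (2 * M j powr (1 / p) * R i)" for i
      by (rule approx) (auto simp: \<Phi>)
    have "(\<integral>\<^sup>+y. ennreal (norm (D j y) * norm (\<Phi> y)) \<partial>haar) \<le>
        (\<integral>\<^sup>+y. ennreal (norm (f y - P j y) * norm (\<Phi> y)) + ennreal (norm (f y - P (Suc j) y) * norm (\<Phi> y)) \<partial>haar)"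
    proof (intro nn_integral_mono)
      fix y
      have "norm (D j y) \<le> norm (f y - P j y) + norm (f y - P (Suc j) y)"
        using norm_triangle_ineq4[of "f y - P j y" "f y - P (Suc j) y"] by (simp add: D_def)
      hence "norm (D j y) * norm (\<Phi> y) \<le> norm (f y - P j y) * norm (\<Phi> y) + norm (f y - P (Suc j) y) * norm (\<Phi> y)"
        unfolding distrib_right[symmetric] by (rule mult_right_mono) simp
      thus "ennreal (norm (D j y) * norm (\<Phi> y)) \<le> ennreal (norm (f y - P j y) * norm (\<Phi> y)) + ennreal (norm (f y - P (Suc j) y) * norm (\<Phi> y))"
        by (simp add: ennreal_leI flip: ennreal_plus)
    qed
    also have "\<dots> = (\<integral>\<^sup>+y. ennreal (norm (f y - P j y) * norm (\<Phi> y)) \<partial>haar) +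
         (\<integral>\<^sup>+y. ennreal (norm (f y - P (Suc j) y) * norm (\<Phi> y)) \<partial>haar)"
      by (rule nn_integral_add) measurable
    also have "\<dots> \<le> ennreal (2 * M j powr (1 / p) * R j) + ennreal (2 * M j powr (1 / p) * R (Suc j))"
      by (intro add_mono approx\<Phi>)
    also have "\<dots> = ennreal (a j)"
      using R_nonneg by (simp add: a_def algebra_simps flip: ennreal_plus)
    finally show ?thesis using \<Phi>(4) by (rule order_trans[rotated])
  qed
  \<comment> \<open>Beppo Levi. Applied to the errors it gives pointwise convergence of the means,
    and applied to the maxima it controls the partial sums.\<close>
  have AE_summable: "AE x in haar. summable (\<lambda>j. u j x)"
    if u [measurable]: "\<And>j. u j \<in> borel_measurable borel" and u0: "\<And>j x. 0 \<le> u j x"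
      and le: "\<And>j. (\<integral>\<^sup>+x. ennreal (u j x) \<partial>haar) \<le> ennreal (a j)" for u :: "nat \<Rightarrow> real ^ 'd \<Rightarrow> real"
  proof -
    have "(\<integral>\<^sup>+x. (\<Sum>j. ennreal (u j x)) \<partial>haar) = (\<Sum>j. \<integral>\<^sup>+x. ennreal (u j x) \<partial>haar)"
      by (rule nn_integral_suminf) measurable
    also have "\<dots> \<le> (\<Sum>j. ennreal (a j))" by (intro suminf_le le) auto
    also have "\<dots> = ennreal (\<Sum>j. a j)" by (rule suminf_ennreal2[OF a(2,1)])
    also have "\<dots> < \<infinity>" by simp
    finally have "AE x in haar. (\<Sum>j. ennreal (u j x)) \<noteq> \<infinity>"
      by (intro nn_integral_noteq_infinite) auto
    thus ?thesis by eventually_elim (rule summable_suminf_not_top, simp_all add: u0)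
  qed
  have coeff: "(\<lambda>j. fourier_coeff (P j) k) \<longlonglongrightarrow> fourier_coeff f k" for k
  proof (rule LIM_zero_cancel, rule Lim_null_comparison)
    show "a \<longlonglongrightarrow> 0" by (rule summable_LIMSEQ_zero[OF a(1)])
    show "eventually (\<lambda>j. norm (fourier_coeff (P j) k - fourier_coeff f k) \<le> a j) sequentially"
    proof (intro always_eventually allI)
      fix j
      have "norm (fourier_coeff (P j) k - fourier_coeff f k) = norm (fourier_coeff (\<lambda>x. f x - P j x) k)"
        using f P_meas P_int by (subst fourier_coeff_diff) (auto simp: norm_minus_commute)
      also have "fourier_coeff (\<lambda>x. f x - P j x) k = (LINT x|haar. (f x - P j x) * cnj (chr k x))"
        by (rule fourier_coeff_haar) measurable
      also have "ennreal (norm \<dots>) \<le> (\<integral>\<^sup>+x. ennreal (norm ((f x - P j x) * cnj (chr k x))) \<partial>haar)"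
        using f P_int by (intro integral_norm_bound_ennreal integrable_mult_chr) auto
      also have "\<dots> \<le> ennreal (a j)" using P_approx[of j] by (simp add: norm_mult)
      finally show "norm (fourier_coeff (P j) k - fourier_coeff f k) \<le> a j"
        using a(2)[of j] by (simp add: ennreal_le_iff)
    qed
  qed
  have "AE x in haar. summable (\<lambda>j. norm (f x - P j x))"
    by (rule AE_summable) (use P_approx in auto)
  moreover have "AE x in haar. summable (\<lambda>j. max_partial_sum (K (Suc j)) (D j) x)"
    by (rule AE_summable) (use max_bound in auto)
  ultimately show ?thesis
  proof eventually_elim
    case (elim x)
    have lim: "(\<lambda>j. P j x) \<longlonglongrightarrow> f x"
    proof (rule LIM_zero_cancel, rule tendsto_norm_zero_cancel)
      show "(\<lambda>j. norm (P j x - f x)) \<longlonglongrightarrow> 0"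
        using summable_LIMSEQ_zero[OF elim(1)] by (simp add: norm_minus_commute)
    qed
    show ?case
      by (rule pringsheim_limit_if_summable_maxima[where P = P and K = K, OF P K(2) _ lim coeff])
        (use elim(2) in \<open>simp add: D_def[abs_def]\<close>)
  qed
qed

section \<open>Choice of scales and summability of the rates\<close>

text \<open>The comparison series telescopes: the differences of (ln j)^(-\<eta>) are of order 1 /
  (j (ln j)^(1+\<eta>)), while the two logarithms in the weight grow like j and ln j.\<close>

lemma summable_log_weights:
  fixes \<eta> :: real
  assumes "\<eta> > 0"
  shows "summable (\<lambda>j. 1 / (ln (exp 1 + 2 ^ j * ln 2) * ln (ln (exp (exp 1) + 2 ^ j * ln 2)) powr (1 + \<eta>)))"
proof (rule summable_comparison_test_bigo)
  let ?\<phi> = "\<lambda>j. ln (real j) powr (- \<eta>)"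
  show "(\<lambda>j. 1 / (ln (exp 1 + 2 ^ j * ln 2) * ln (ln (exp (exp 1) + 2 ^ j * ln 2)) powr (1 + \<eta>)))
      \<in> O(\<lambda>j. ?\<phi> j - ?\<phi> (Suc j))"
    using assms by real_asymp
  have "?\<phi> \<longlonglongrightarrow> 0" using assms by real_asymp
  hence "summable (\<lambda>j. ?\<phi> j - ?\<phi> (Suc j))" by (rule telescope_summable')
  moreover have "eventually (\<lambda>j. norm (?\<phi> j - ?\<phi> (Suc j)) = ?\<phi> j - ?\<phi> (Suc j)) sequentially"
    \<comment> \<open>From 2 on \<open>ln j\<close> is positive, so its negative power
      decreases.\<close>
    using eventually_ge_at_top[of 2]
  proof eventually_elim
    case (elim j)
    have "?\<phi> (Suc j) \<le> ?\<phi> j" using elim assms by (intro powr_mono2') auto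
    thus ?case by simp
  qed
  ultimately show "summable (\<lambda>j. norm (?\<phi> j - ?\<phi> (Suc j)))"
    by (subst summable_cong) auto
qed

lemma summable_doubly_exponential:
  fixes s :: real
  shows "summable (\<lambda>j :: nat. (22 * (2 ^ j * ln 2)) powr s / 4 ^ (2 ^ j))"
proof (rule summable_comparison_test_bigo)
  show "summable (\<lambda>j :: nat. norm ((1 / 2 :: real) ^ j))" by (simp add: summable_geometric)
  show "(\<lambda>j :: nat. (22 * (2 ^ j * ln 2)) powr s / 4 ^ (2 ^ j)) \<in> O(\<lambda>j. (1 / 2) ^ j)"
    by real_asymp
qed

text \<open>With X = 2^(8 * 2^j), 4 X + 3 \<le> 8 X = 2^(3 + 8 * 2^j) \<le> 2^(11 * 2^j). The factor
  2 in the Lebesgue bound turns 11 into 22.\<close>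

lemma lebesgue_bound_powr_le:
  assumes "0 < p"
  shows "lebesgue_bound d (2 ^ (4 * 2 ^ Suc j)) powr (1 / p) \<le> (22 * (2 ^ j * ln 2)) powr (real d / p)"
proof -
  define X where "X = (2 :: real) ^ (8 * 2 ^ j)"
  have "1 \<le> X" unfolding X_def by (rule one_le_power) simp
  moreover have "real (2 ^ (4 * 2 ^ Suc j)) = X" by (simp add: X_def mult.assoc)
  ultimately have "4 * real (2 ^ (4 * 2 ^ Suc j)) + 3 \<le> 8 * 2 ^ (8 * 2 ^ j)"
    unfolding X_def[symmetric] by linarith
  also have "\<dots> = 2 ^ (3 + 8 * 2 ^ j)" by (simp add: power_add)
  also have "\<dots> \<le> 2 ^ (11 * 2 ^ j)"
    using one_le_power[of "2 :: nat" j] by (intro power_increasing) auto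
  finally have "ln (4 * real (2 ^ (4 * 2 ^ Suc j)) + 3) \<le> ln (2 ^ (11 * 2 ^ j))"
    by (subst ln_le_cancel_iff) (auto intro: add_pos_pos)
  hence le: "2 * ln (4 * real (2 ^ (4 * 2 ^ Suc j)) + 3) \<le> 22 * (2 ^ j * ln 2)"
    by (simp add: ln_realpow mult.commute)
  have "1 < 4 * real (2 ^ (4 * 2 ^ Suc j)) + 3" using of_nat_0_le_iff[of "2 ^ (4 * 2 ^ Suc j)"] by linarith
  hence pos: "0 < 2 * ln (4 * real (2 ^ (4 * 2 ^ Suc j)) + 3)" by (intro mult_pos_pos ln_gt_zero) auto
  have "lebesgue_bound d (2 ^ (4 * 2 ^ Suc j)) = (2 * ln (4 * real (2 ^ (4 * 2 ^ Suc j)) + 3)) powr real d"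
    unfolding lebesgue_bound_def using pos by (simp only: powr_realpow)
  also have "\<dots> powr (1 / p) = (2 * ln (4 * real (2 ^ (4 * 2 ^ Suc j)) + 3)) powr (real d / p)"
    by (simp add: powr_powr)
  also have "\<dots> \<le> (22 * (2 ^ j * ln 2)) powr (real d / p)"
    using pos le assms by (intro powr_mono2) auto
  finally show ?thesis .
qed

text \<open>Serves only to make differences of translates integrable, so a crude constant will
  do.\<close>

lemma powr_norm_diff_le:
  fixes a b :: complex
  assumes "0 \<le> p"
  shows "norm (a - b) powr p \<le> 2 powr p * (norm a powr p + norm b powr p)"
proof -
  have "norm (a - b) \<le> 2 * max (norm a) (norm b)"
    using norm_triangle_ineq4[of a b] by simp
  hence "norm (a - b) powr p \<le> (2 * max (norm a) (norm b)) powr p"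
    using assms by (intro powr_mono2) auto
  also have "\<dots> = 2 powr p * max (norm a) (norm b) powr p" by (simp add: powr_mult max_def)
  also have "\<dots> \<le> 2 powr p * (norm a powr p + norm b powr p)"
    by (intro mult_left_mono) (auto simp: max_def)
  finally show ?thesis .
qed

text \<open>At \<delta> = 2^(-2^j) the logarithms in the hypothesis have closed forms in
  \<open>L j\<close>. The Lebesgue bound contributes at most a constant times
  \<open>L j powr s\<close>, the modulus the reciprocal power, and what is left is the summable
  \<open>b\<close>.\<close>

lemma AE_pringsheim_borel:
  fixes f :: "real ^ 'd \<Rightarrow> complex" and p \<eta> A :: real
  assumes \<eta>: "\<eta> > 0" and p: "1 \<le> p" "p \<le> 2"
    and f: "torus_periodic f" and f_meas [measurable]: "f \<in> borel_measurable borel"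
    and f_int: "integrable haar (\<lambda>x. norm (f x) powr p)"
    and modulus: "\<And>\<delta> h. 0 < \<delta> \<Longrightarrow> \<delta> \<le> 1 / 2 \<Longrightarrow> torus_abs h \<le> \<delta> \<Longrightarrow>
      (LINT x|haar. norm (f (x + h) - f x) powr p) powr (1 / p) \<le>
        A / (ln (1 / \<delta>) powr (real CARD('d) / p) * ln (ln (exp (exp 1) / \<delta>))
             * ln (ln (ln (exp (exp (exp 1)) / \<delta>))) powr (1 + \<eta>))"
  shows "AE x in haar. ((\<lambda>n. rect_partial_sum n f x) \<longlongrightarrow> f x) pringsheim"
proof -
  define s where "s = real CARD('d) / p"
  define b where "b j = 1 / (ln (exp 1 + 2 ^ j * ln 2) * ln (ln (exp (exp 1) + 2 ^ j * ln 2)) powr (1 + \<eta>))" for j :: nat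
  define L where "L j = 2 ^ j * ln (2 :: real)" for j :: nat
  \<comment> \<open>The given constant may be zero or negative, while the rates \<open>W\<close>
    must be positive.\<close>
  define A' where "A' = max A 1"
  define \<delta> where "\<delta> j = (1 :: real) / 2 ^ (2 ^ j)" for j :: nat
  define W where "W j = A' * b j / L j powr s" for j
  \<comment> \<open>The exponent 4 exceeds the 2 coming from \<delta>^2, so
    \<open>K j * (\<delta> j)^2\<close> is 4^(2^j); the Fejer tail then beats every power of
    \<open>L j\<close>.\<close>
  define K where "K j = (2 :: nat) ^ (4 * 2 ^ j)" for j :: nat
  have s: "s > 0" using p by (simp add: s_def)
  have L: "L j > 0" for j by (simp add: L_def)
  have b: "b j > 0" for j
  proof -
    have ln_gt: "x < ln (exp x + L j)" for x
    proof -
      have "ln (exp x) < ln (exp x + L j)" using L[of j] by (subst ln_less_cancel_iff) (auto intro: add_pos_pos)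
      thus ?thesis by simp
    qed
    have "ln (exp 1) < ln (ln (exp (exp 1) + L j))"
      using ln_gt[of "exp 1"] by (subst ln_less_cancel_iff) (auto intro: less_trans[of 0 "exp 1"])
    thus ?thesis using ln_gt[of 1] unfolding b_def L_def[symmetric] by simp
  qed
  have W: "W j > 0" for j using b[of j] L[of j] by (simp add: W_def A'_def)
  have \<delta>: "0 < \<delta> j" "\<delta> j \<le> 1 / 2" for j
  proof -
    have "(2 :: real) ^ 1 \<le> 2 ^ (2 ^ j)" by (rule power_increasing) auto
    thus "\<delta> j \<le> 1 / 2" by (simp add: \<delta>_def field_simps)
  qed (simp add: \<delta>_def)
  have ln_\<delta>: "ln (exp x / \<delta> j) = x + L j" for x j
    by (simp add: \<delta>_def ln_mult ln_realpow L_def)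
  have ln_\<delta>': "ln (1 / \<delta> j) = L j" for j
    using ln_\<delta>[of 0 j] by simp
  have modulus_j: "(LINT x|haar. norm (f (x + h) - f x) powr p) powr (1 / p) \<le> W j"
    if "torus_abs h \<le> \<delta> j" for j h
  proof -
    have "(LINT x|haar. norm (f (x + h) - f x) powr p) powr (1 / p) \<le> A * (b j / L j powr s)"
      using modulus[OF \<delta> that] by (simp add: ln_\<delta> ln_\<delta>' b_def L_def s_def mult_ac)
    also have "\<dots> \<le> A' * (b j / L j powr s)"
      using b[of j] L[of j] by (intro mult_right_mono) (auto simp: A'_def)
    finally show ?thesis by (simp add: W_def)
  qed
  have fW: "(\<integral>\<^sup>+x. ennreal (norm (f (x + h) - f x) powr p) \<partial>haar) \<le> ennreal (W j powr p)"
    if h: "torus_abs h \<le> \<delta> j" for j h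
  proof -
    have "integrable haar (\<lambda>x. complex_of_real (norm (f x) powr p))"
      using f_int by (simp add: complex_of_real_integrable_eq)
    hence "integrable haar (\<lambda>x. complex_of_real (norm (f (x + h)) powr p))"
      using f by (subst integrable_haar_shift[where f = "\<lambda>x. complex_of_real (norm (f x) powr p)"])
        (auto simp: torus_periodic_def)
    hence "integrable haar (\<lambda>x. norm (f (x + h)) powr p)" by (simp only: complex_of_real_integrable_eq)
    hence "integrable haar (\<lambda>x. 2 powr p * (norm (f (x + h)) powr p + norm (f x) powr p))"
      using f_int by simp
    hence int: "integrable haar (\<lambda>x. norm (f (x + h) - f x) powr p)"
      by (rule Bochner_Integration.integrable_bound)
        (use p in \<open>auto simp: powr_norm_diff_le\<close>)
    define I where "I = (LINT x|haar. norm (f (x + h) - f x) powr p)"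
    have "0 \<le> I" unfolding I_def by (intro integral_nonneg_AE) auto
    hence "I = (I powr (1 / p)) powr p" using p by (simp add: powr_powr)
    also have "\<dots> \<le> W j powr p"
      using modulus_j[OF h] p by (intro powr_mono2) (auto simp: I_def)
    finally have "I \<le> W j powr p" .
    moreover have "(\<integral>\<^sup>+x. ennreal (norm (f (x + h) - f x) powr p) \<partial>haar) = ennreal I"
      unfolding I_def by (rule nn_integral_eq_integral[OF int]) auto
    ultimately show ?thesis by (simp add: ennreal_leI)
  qed
  \<comment> \<open>Adding 1 keeps \<open>B\<close> positive even if \<open>f\<close> vanishes
    almost everywhere.\<close>
  define B where "B = (LINT x|haar. norm (f x) powr p) powr (1 / p) + 1"
  have B: "B > 0" by (simp add: B_def add_nonneg_pos)
  have fB: "(\<integral>\<^sup>+x. ennreal (norm (f x) powr p) \<partial>haar) \<le> ennreal (B powr p)"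
  proof -
    define I where "I = (LINT x|haar. norm (f x) powr p)"
    have "0 \<le> I" unfolding I_def by (intro integral_nonneg_AE) auto
    hence "I = (I powr (1 / p)) powr p" using p by (simp add: powr_powr)
    also have "\<dots> \<le> B powr p" using p by (intro powr_mono2) (auto simp: B_def I_def)
    finally have "I \<le> B powr p" .
    moreover have "(\<integral>\<^sup>+x. ennreal (norm (f x) powr p) \<partial>haar) = ennreal I"
      unfolding I_def by (rule nn_integral_eq_integral[OF f_int]) auto
    ultimately show ?thesis by (simp add: ennreal_leI)
  qed
  \<comment> \<open>The measure is finite, and |f| \<le> 1 + |f|^p for p \<ge> 1.\<close>
  have f_int1: "integrable haar f"
  proof (rule Bochner_Integration.integrable_bound)
    show "integrable haar (\<lambda>x. 1 + norm (f x) powr p)" using f_int by simp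
    show "AE x in haar. norm (f x) \<le> norm (1 + norm (f x) powr p)"
    proof (intro AE_I2)
      fix x
      have "norm (f x) \<le> norm (f x) powr p" if "1 \<le> norm (f x)"
        using powr_mono[of 1 p "norm (f x)"] p that by simp
      thus "norm (f x) \<le> norm (1 + norm (f x) powr p)"
        by (cases "1 \<le> norm (f x)") (auto intro: add_increasing2 order_trans)
    qed
  qed measurable
  define C where "C = 2 * B * (real CARD('d) * pi\<^sup>2)"
  define R where "R j = W j + C / 4 ^ (2 ^ j)" for j :: nat
  have K\<delta>: "real (K j) * (\<delta> j)\<^sup>2 = 4 ^ (2 ^ j)" for j
  proof -
    have "real (K j) * (\<delta> j)\<^sup>2 = (2 ^ 2 ^ j) ^ 4 / (2 ^ 2 ^ j)\<^sup>2"
      by (simp add: K_def \<delta>_def power_divide mult.commute[of 4] power_mult)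
    also have "\<dots> = (2 ^ 2 ^ j)\<^sup>2" by (simp add: power2_eq_square power4_eq_xxxx)
    also have "\<dots> = 4 ^ (2 ^ j)" by (simp add: mult.commute flip: power_mult) (simp add: power_mult)
    finally show ?thesis .
  qed
  have R_eq: "R j = W j + 2 * B * (real CARD('d) * (pi\<^sup>2 / (real (K j) * (\<delta> j)\<^sup>2)))" for j
    by (simp add: R_def C_def K\<delta>)
  have C: "C \<ge> 0" using B by (simp add: C_def)
  show ?thesis
  proof (rule AE_pringsheim_if_summable_rates[OF p B W _ _ \<delta>(1) f f_meas f_int1 fB fW R_eq])
    show "1 \<le> K j" for j by (simp add: K_def)
    show "incseq K" unfolding K_def incseq_def by (auto intro!: power_increasing)
    have bL: "b j = 1 / (ln (exp 1 + 2 ^ j * ln 2) * ln (ln (exp (exp 1) + 2 ^ j * ln 2)) powr (1 + \<eta>))" for j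
      by (rule b_def)
    have b_summable: "summable b" unfolding bL[abs_def] by (rule summable_log_weights[OF \<eta>])
    define E where "E j = (22 * L j) powr s / 4 ^ (2 ^ j)" for j
    have E_summable: "summable E"
      unfolding E_def[abs_def] L_def by (rule summable_doubly_exponential)
    have "summable (\<lambda>j. 22 powr s * A' * (b j + b (Suc j)) + 2 * C * E j)"
      using b_summable E_summable summable_Suc_iff[of b]
      by (intro summable_add summable_mult) auto
    thus "summable (\<lambda>j. lebesgue_bound CARD('d) (K (Suc j)) powr (1 / p) * (R j + R (Suc j)))"
    proof (rule summable_comparison_test'[where N = 0])
      fix j
      \<comment> \<open>Both stages are put over the denominator \<open>L j powr s\<close>, which
        then cancels the growth of the Lebesgue bound.\<close>
      have L_Suc: "L j powr s \<le> L (Suc j) powr s"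
        using s L[of j] by (intro powr_mono2) (auto simp: L_def)
      have "W (Suc j) \<le> A' * b (Suc j) / L j powr s"
        unfolding W_def using b[of "Suc j"] L[of j] L[of "Suc j"] L_Suc
        by (intro divide_left_mono) (auto simp: A'_def)
      moreover have "C / 4 ^ (2 ^ Suc j) \<le> C / 4 ^ (2 ^ j)"
        using C by (intro divide_left_mono power_increasing) auto
      ultimately have R_le: "R j + R (Suc j) \<le> A' * (b j + b (Suc j)) / L j powr s + 2 * C / 4 ^ (2 ^ j)"
        by (simp add: R_def W_def distrib_left add_divide_distrib)
      have R0: "0 \<le> R j + R (Suc j)" using W[of j] W[of "Suc j"] C by (simp add: R_def)
      have "lebesgue_bound CARD('d) (K (Suc j)) powr (1 / p) \<le> (22 * L j) powr s"
        unfolding K_def L_def s_def using p by (intro lebesgue_bound_powr_le) auto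
      hence "lebesgue_bound CARD('d) (K (Suc j)) powr (1 / p) * (R j + R (Suc j)) \<le>
            (22 * L j) powr s * (A' * (b j + b (Suc j)) / L j powr s + 2 * C / 4 ^ (2 ^ j))"
        using R_le R0 by (intro mult_mono) auto
      also have "\<dots> = 22 powr s * A' * (b j + b (Suc j)) + 2 * C * E j"
        using L[of j] by (simp add: E_def powr_mult field_simps)
      finally show "norm (lebesgue_bound CARD('d) (K (Suc j)) powr (1 / p) * (R j + R (Suc j))) \<le>
          22 powr s * A' * (b j + b (Suc j)) + 2 * C * E j"
        using R0 by (simp add: abs_mult)
    qed
  qed
qed

section \<open>Passage from Lebesgue measurable to Borel functions\<close>

text \<open>A Borel function equal to \<open>f\<close> off a null set need not be periodic;
  composition with \<open>wrap\<close> repairs this. Agreement is asserted for every translate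
  because the modulus compares \<open>f (x + h)\<close> with \<open>f x\<close>; the exceptional set
  stays null under translation by invariance of \<open>haar\<close>.\<close>

lemma torus_periodic_borel_version:
  fixes f :: "real ^ 'd \<Rightarrow> complex"
  assumes f: "torus_periodic f" and meas: "f \<in> borel_measurable lebesgue"
  obtains g where "torus_periodic g" "g \<in> borel_measurable borel"
    and "\<And>h. AE x in torus_measure. f (x + h) = g (x + h)"
proof -
  have "(\<lambda>x. Re (f x)) \<in> borel_measurable lebesgue" "(\<lambda>x. Im (f x)) \<in> borel_measurable lebesgue"
    using meas by measurable
  then obtain u v where [measurable]: "u \<in> borel_measurable lborel" "v \<in> borel_measurable lborel"
    and uv: "AE x in lborel. Re (f x) = u x" "AE x in lborel. Im (f x) = v x"
    by (auto dest!: completion_ex_borel_measurable_real)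
  define w where "w x = Complex (u x) (v x)" for x
  have w_eq: "w = (\<lambda>x. complex_of_real (u x) + \<i> * complex_of_real (v x))"
    by (simp add: fun_eq_iff w_def Complex_eq)
  have [measurable]: "w \<in> borel_measurable borel" unfolding w_eq by measurable
  have "AE x in lborel. f x = w x"
    using uv by eventually_elim (simp add: w_def complex_eq_iff)
  then obtain N where N: "{x \<in> space lborel. f x \<noteq> w x} \<subseteq> N" "N \<in> sets lborel" "emeasure lborel N = 0"
    by (auto elim: AE_E)
  hence [measurable]: "N \<in> sets borel" by simp
  have "AE x in lborel. x \<notin> N" using N by (intro AE_I[of _ _ N]) auto
  hence "AE x in (haar :: (real ^ 'd) measure). x \<notin> N"
    unfolding haar_def by (subst AE_density) auto
  hence "AE x in distr haar borel (\<lambda>x :: real ^ 'd. wrap (x + h)). x \<notin> N" for h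
    by (simp only: haar_shift)
  hence shift: "AE x in (haar :: (real ^ 'd) measure). wrap (x + h) \<notin> N" for h
    by (subst (asm) AE_distr_iff) auto
  show ?thesis
  proof (rule that[of "\<lambda>x. w (wrap x)"])
    show "torus_periodic (\<lambda>x. w (wrap x))" by (rule torus_periodic_comp_wrap)
    show "AE x in torus_measure. f (x + h) = w (wrap (x + h))" for h
    proof (rule AE_torus_measure_if_AE_haar)
      show "AE x in haar. f (x + h) = w (wrap (x + h))"
        using shift[of h]
      proof eventually_elim
        case (elim x)
        have "f (x + h) = f (wrap (x + h))" by (simp add: torus_periodic_wrap[OF f])
        also have "\<dots> = w (wrap (x + h))" using N(1) elim by auto
        finally show ?case .
      qed
    qed
  qed measurable
qed

text \<open>Translation is the diagonal affine map with all factors 1, and such maps are measurable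
  for the completed sigma-algebra.\<close>

lemma lebesgue_measurable_shift:
  fixes f :: "real ^ 'd \<Rightarrow> complex"
  assumes "f \<in> borel_measurable lebesgue"
  shows "(\<lambda>x. f (x + h)) \<in> borel_measurable lebesgue"
proof -
  have "(\<lambda>x. h + (\<Sum>j\<in>Basis. (1 * (x \<bullet> j)) *\<^sub>R j)) \<in> measurable lebesgue (lebesgue :: (real ^ 'd) measure)"
    by (rule lebesgue_affine_measurable) simp
  hence "(\<lambda>x. x + h) \<in> measurable lebesgue (lebesgue :: (real ^ 'd) measure)"
    by (simp add: euclidean_representation add.commute)
  thus ?thesis using assms by (rule measurable_compose)
qed

theorem corollary1p4:
  fixes f :: "real ^ 'd \<Rightarrow> complex" and p \<eta> :: real
  assumes "CARD('d) \<ge> 2" and "\<eta> > 0" and "1 \<le> p" and "p \<le> 2"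
    and "f \<in> torus_Lp p"
    and "\<exists>A :: real. \<forall>\<delta>. 0 < \<delta> \<and> \<delta> \<le> 1 / 2 \<longrightarrow>
           Lp_modulus p \<delta> f \<le>
             ereal (A / (ln (1 / \<delta>) powr (real CARD('d) / p)
                         * ln (ln (exp (exp 1) / \<delta>))
                         * ln (ln (ln (exp (exp (exp 1)) / \<delta>))) powr (1 + \<eta>)))"
  shows "AE x in torus_measure. ((\<lambda>n. rect_partial_sum n f x) \<longlongrightarrow> f x) pringsheim"
proof -
  have f: "torus_periodic f" "f \<in> borel_measurable lebesgue"
    and f_int: "integrable torus_measure (\<lambda>x. norm (f x) powr p)"
    using assms(5) by (auto simp: torus_Lp_def)
  obtain g where g: "torus_periodic g" "g \<in> borel_measurable borel"
    and fg: "\<And>h. AE x in torus_measure. f (x + h) = g (x + h)"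
    by (rule torus_periodic_borel_version[OF f]) (rule that)
  have fg0: "AE x in torus_measure. f x = g x" using fg[of 0] by simp
  note [measurable] = g(2)
  have torus_meas: "measurable torus_measure (borel :: complex measure) = borel_measurable lebesgue"
    by (intro measurable_cong_sets) auto
  have f_meas: "f \<in> borel_measurable torus_measure" "(\<lambda>x. f (x + h)) \<in> borel_measurable torus_measure" for h
    using f(2) lebesgue_measurable_shift[OF f(2)] by (simp_all add: torus_meas)
  have g_meas: "g \<in> borel_measurable torus_measure" "(\<lambda>x. g (x + h)) \<in> borel_measurable torus_measure" for h
    by (simp_all add: torus_meas measurable_completion)
  note [measurable] = f_meas g_meas
  have "integrable torus_measure (\<lambda>x. norm (g x) powr p)"
  proof (rule integrable_cong_AE_imp[OF f_int])
    show "AE x in torus_measure. norm (f x) powr p = norm (g x) powr p"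
      using fg0 by eventually_elim simp
  qed measurable
  hence g_int: "integrable haar (\<lambda>x. norm (g x) powr p)"
    by (subst (asm) integrable_torus_measure) auto
  obtain A where A: "\<And>\<delta>. 0 < \<delta> \<Longrightarrow> \<delta> \<le> 1 / 2 \<Longrightarrow> Lp_modulus p \<delta> f \<le>
             ereal (A / (ln (1 / \<delta>) powr (real CARD('d) / p)
                         * ln (ln (exp (exp 1) / \<delta>))
                         * ln (ln (ln (exp (exp (exp 1)) / \<delta>))) powr (1 + \<eta>)))"
    using assms(6) by blast
  have "AE x in haar. ((\<lambda>n. rect_partial_sum n g x) \<longlongrightarrow> g x) pringsheim"
  proof (rule AE_pringsheim_borel[OF assms(2-4) g g_int])
    fix \<delta> :: real and h :: "real ^ 'd" assume \<delta>: "0 < \<delta>" "\<delta> \<le> 1 / 2" and h: "torus_abs h \<le> \<delta>"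
    have "(LINT x|haar. norm (g (x + h) - g x) powr p) = (LINT x|torus_measure. norm (g (x + h) - g x) powr p)"
      by (rule integral_torus_measure[symmetric]) measurable
    also have "\<dots> = (LINT x|torus_measure. norm (f (x + h) - f x) powr p)"
    proof (rule integral_cong_AE)
      show "AE x in torus_measure. norm (g (x + h) - g x) powr p = norm (f (x + h) - f x) powr p"
        using fg[of h] fg0 by eventually_elim simp
    qed measurable
    finally have "ereal ((LINT x|haar. norm (g (x + h) - g x) powr p) powr (1 / p)) \<le> Lp_modulus p \<delta> f"
      unfolding Lp_modulus_def torus_Lp_norm_def using h by (auto intro!: SUP_upper2)
    also note A[OF \<delta>]
    finally show "(LINT x|haar. norm (g (x + h) - g x) powr p) powr (1 / p) \<le>
        A / (ln (1 / \<delta>) powr (real CARD('d) / p) * ln (ln (exp (exp 1) / \<delta>))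
             * ln (ln (ln (exp (exp (exp 1)) / \<delta>))) powr (1 + \<eta>))"
      by simp
  qed
  hence g_lim: "AE x in torus_measure. ((\<lambda>n. rect_partial_sum n g x) \<longlongrightarrow> g x) pringsheim"
    by (rule AE_torus_measure_if_AE_haar)
  \<comment> \<open>Fourier coefficients do not see null sets, so the partial sums agree at every
    point and for every n at once; only the limits \<open>f x\<close> and \<open>g x\<close> differ,
    on a null set.\<close>
  have sums_eq: "rect_partial_sum n f x = rect_partial_sum n g x" for n x
  proof -
    have "fourier_coeff f k = fourier_coeff g k" for k
      unfolding fourier_coeff_def
    proof (rule integral_cong_AE)
      have [measurable]: "(\<lambda>x. exp (- (\<i> * complex_of_real (freq_dot k x)))) \<in> borel_measurable torus_measure"
        unfolding torus_meas
        by (intro measurable_completion) (simp add: borel_measurable_continuous_onI freq_dot_def continuous_intros)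
      show "(\<lambda>x. f x * exp (- (\<i> * complex_of_real (freq_dot k x)))) \<in> borel_measurable torus_measure"
        "(\<lambda>x. g x * exp (- (\<i> * complex_of_real (freq_dot k x)))) \<in> borel_measurable torus_measure"
        by measurable
      show "AE x in torus_measure. f x * exp (- (\<i> * complex_of_real (freq_dot k x))) =
          g x * exp (- (\<i> * complex_of_real (freq_dot k x)))"
        using fg0 by eventually_elim simp
    qed
    thus ?thesis by (simp add: rect_partial_sum_def)
  qed
  show ?thesis
    using g_lim fg0 by eventually_elim (simp only: sums_eq)
qed

end
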